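(* Let $(A,\Delta,\epsilon,\mathcal R)$ be a quasi-triangular Hopf superalgebra over a field $K$, and let $F(\lambda)\in A\otimes A$ be a twistor depending on $\lambda\in A$ which is a shifted cocycle, i.e. for a fixed $h\in A$, with $h^{(1)}=h\otimes1\otimes1$, $$F_{12}(\lambda)\cdot(\Delta\otimes1)F(\lambda)=F_{23}(\lambda+h^{(1)})\cdot(1\otimes\Delta)F(\lambda).$$ Let $(A,\Delta_\lambda,\epsilon,\Phi(\lambda),\mathcal R(\lambda))$ be the quasi-triangular quasi-Hopf superalgebra obtained by twisting with $F(\lambda)$, i.e. $\Delta_\lambda(a)=F(\lambda)\Delta(a)F(\lambda)^{-1}$, $\mathcal R(\lambda)=F(\lambda)^T\mathcal R F(\lambda)^{-1}$ and $$\Phi(\lambda)=F_{12}(\lambda)\cdot(\Delta\otimes1)F(\lambda)\cdot(1\otimes\Delta)F(\lambda)^{-1}\cdot F_{23}(\lambda)^{-1}.$$ Then $$\Phi(\lambda)=F_{23}(\lambda+h^{(1)})F_{23}(\lambda)^{-1},$$ $$\Delta_\lambda(a)^T\,\mathcal R(\lambda)=\mathcal R(\lambda)\Delta_\lambda(a)\quad\text{for all }a\in A,$$ $$(\Delta_\lambda\otimes1)\mathcal R(\lambda)=\Phi_{231}(\lambda)^{-1}\mathcal R_{13}(\lambda)\mathcal R_{23}(\lambda+h^{(1)}),$$ $$(1\otimes\Delta_\lambda)\mathcal R(\lambda)=\mathcal R_{13}(\lambda+h^{(2)})\mathcal R_{12}(\lambda)\Phi_{123}(\lambda).$$ As a corollary,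 $\mathcal R(\lambda)$ satisfies the graded dynamical Yang–Baxter equation $$\mathcal R_{12}(\lambda+h^{(3)})\mathcal R_{13}(\lambda)\mathcal R_{23}(\lambda+h^{(1)})=\mathcal R_{23}(\lambda)\mathcal R_{13}(\lambda+h^{(2)})\mathcal R_{12}(\lambda).$$
   Context: All algebras are unital, associative and $\mathbf{Z}_2$-graded; $[a]\in\mathbf{Z}_2$ is the degree of a homogeneous element $a$. Tensor products carry the graded multiplication $(a\otimes b)(a'\otimes b')=(-1)^{[b][a']}aa'\otimes bb'$ (similarly for more factors). Structure maps preserve degree ($K$ in degree $0$). In expressions such as $(\Delta\otimes1)$, "$1$" denotes the identity map. Quasi-triangular Hopf superalgebra: $A$ with degree-preserving algebra homomorphisms $\Delta:A\to A\otimes A$, $\epsilon:A\to K$ and a graded algebra anti-homomorphism $S:A\to A$ ($S(ab)=(-1)^{[a][b]}S(b)S(a)$) satisfying coassociativity $(\Delta\otimes1)\Delta=(1\otimes\Delta)\Delta$, the co-unit axioms $(\epsilon\otimes1)\Delta=1=(1\otimes\epsilon)\Delta$, the antipode axioms $\sum S(a_{(1)})a_{(2)}=\epsilon(a)1=\sum a_{(1)}S(a_{(2)})$ where $\Delta(a)=\sum a_{(1)}\otimes a_{(2)}$, together with an invertible homogeneous $\mathcal R\in A\otimes A$ with $\Delta^T(a)\mathcal R=\mathcal R\Delta(a)$ for all $a$, $(\Delta\otimes1)\mathcal R=\mathcal R_{13}\mathcal R_{23}$, $(1\otimes\Delta)\mathcal R=\mathcal R_{13}\mathcal R_{12}$.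 (This is a quasi-triangular quasi-Hopf superalgebra with $\alpha=\beta=1$ and co-associator $1\otimes1\otimes1$.) The graded twist map is $T(a\otimes b)=(-1)^{[a][b]}b\otimes a$ for homogeneous $a,b$; $\Delta^T=T\cdot\Delta$, $\Delta_\lambda(a)^T=T(\Delta_\lambda(a))$, $F^T=T(F)=F_{21}$. A twistor is an invertible homogeneous (hence even) element $F\in A\otimes A$ with $(\epsilon\otimes1)F=1=(1\otimes\epsilon)F$. Index notation: for $X\in A\otimes A$, $X_{12}=X\otimes1$, $X_{23}=1\otimes X$, $X_{13}=(1\otimes T)X_{12}$. For $\Phi\in A^{\otimes3}$, $\Phi_{123}=\Phi$ and $\Phi_{231}=(1\otimes T)(T\otimes1)\Phi$. Shifts: $\lambda$ depends on one or several parameters, and $h\in A$ is a fixed even element; $h^{(i)}\in A^{\otimes3}$ is $h$ placed in the $i$-th factor. $F_{23}(\lambda+h^{(1)})$ is the invertible element of $A^{\otimes3}$ obtained from $F_{23}(\lambda)$ by substituting $\lambda+h^{(1)}$ for $\lambda$ (concretely, when $\lambda=\sum_l\lambda_lh^l$ with parameters $\lambda_l$, $\lambda+h^{(1)}=\sum_l(\lambda_l+h_l^{(1)})h^l$, i.e. each parameter $\lambda_l$ is replaced by $\lambda_l+h_l^{(1)}$). The other shifted elements $F_{jk}(\lambda+h^{(i)})$, $\{i,j,k\}=\{1,2,3\}$, are obtained from $F_{23}(\lambda+h^{(1)})$ by the graded permutation of tensor factors sending factors $1,2,3$ to positions $i,j,k$, and $\mathcal R_{jk}(\lambda+h^{(i)})=F_{kj}(\lambda+h^{(i)})\,\mathcal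 R_{jk}\,F_{jk}(\lambda+h^{(i)})^{-1}$. *)

theory Defs
  imports Complex_Main "HOL-Library.Z2" "HOL-Library.Poly_Mapping"
begin

section \<open>Superalgebras and graded tensor products\<close>

text \<open>Degrees are elements of the two-element field \<^typ>\<open>bit\<close>.\<close>

locale superalgebra = vector_space scale
  for scale :: "'k::field \<Rightarrow> 'a::ring_1 \<Rightarrow> 'a" +
  fixes grd :: "bit \<Rightarrow> 'a set"
  assumes scale_mult_left: "scale c x * y = scale c (x * y)"
    and scale_mult_right: "x * scale c y = scale c (x * y)"
    and subspace_grd: "subspace (grd i)"
    and grd_disjoint: "grd 0 \<inter> grd 1 = {0}"
    and grd_decomp: "\<exists>x0\<in>grd 0. \<exists>x1\<in>grd 1. x = x0 + x1"
    and one_grd: "1 \<in> grd 0"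
    and mult_grd: "x \<in> grd i \<Longrightarrow> y \<in> grd j \<Longrightarrow> x * y \<in> grd (i + j)"

definition koszul_sign :: "bit \<Rightarrow> bit \<Rightarrow> 'k::field" where
  "koszul_sign i j = (if i * j = 1 then - 1 else 1)"

definition free_scale :: "'k::field \<Rightarrow> ('x \<Rightarrow>\<^sub>0 'k) \<Rightarrow> ('x \<Rightarrow>\<^sub>0 'k)" where
  "free_scale c = Poly_Mapping.map (\<lambda>d. c * d)"

inductive_set tensor_relations ::
    "('k::field \<Rightarrow> 'a::ab_group_add \<Rightarrow> 'a) \<Rightarrow> ('k \<Rightarrow> 'b::ab_group_add \<Rightarrow> 'b) \<Rightarrow> ('a \<times> 'b \<Rightarrow>\<^sub>0 'k) set"
  for sA sB where
  "Poly_Mapping.single (x + x', y) 1 - Poly_Mapping.single (x, y) 1 - Poly_Mapping.single (x', y) 1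
     \<in> tensor_relations sA sB"
| "Poly_Mapping.single (x, y + y') 1 - Poly_Mapping.single (x, y) 1 - Poly_Mapping.single (x, y') 1
     \<in> tensor_relations sA sB"
| "Poly_Mapping.single (sA c x, y) 1 - Poly_Mapping.single (x, y) c \<in> tensor_relations sA sB"
| "Poly_Mapping.single (x, sB c y) 1 - Poly_Mapping.single (x, y) c \<in> tensor_relations sA sB"

definition tensor_eval ::
    "('k::field \<Rightarrow> 't::ab_group_add \<Rightarrow> 't) \<Rightarrow> ('a \<Rightarrow> 'b \<Rightarrow> 't) \<Rightarrow> ('a \<times> 'b \<Rightarrow>\<^sub>0 'k) \<Rightarrow> 't" where
  "tensor_eval sT tens f =
     (\<Sum>p\<in>Poly_Mapping.keys f. sT (Poly_Mapping.lookup f p) (tens (fst p) (snd p)))"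

text \<open>The tensor product is the free vector space on pairs modulo the bilinearity relations.
  Since a quotient depending on the scalar multiplications is not a type, a type \<open>'t\<close> with a map
  \<open>tens\<close> is called a tensor product if it is that quotient up to isomorphism, i.e. the
  canonical map from formal sums is onto and its kernel is spanned by the relations.\<close>

definition is_tensor_product ::
    "('k::field \<Rightarrow> 'a::ab_group_add \<Rightarrow> 'a) \<Rightarrow> ('k \<Rightarrow> 'b::ab_group_add \<Rightarrow> 'b) \<Rightarrow>
     ('k \<Rightarrow> 't::ab_group_add \<Rightarrow> 't) \<Rightarrow> ('a \<Rightarrow> 'b \<Rightarrow> 't) \<Rightarrow> bool" where
  "is_tensor_product sA sB sT tens \<longleftrightarrow>
     vector_space sA \<and> vector_space sB \<and> vector_space sT \<and>
     surj (tensor_eval sT tens) \<and>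
     (\<forall>f. tensor_eval sT tens f = 0 \<longleftrightarrow> f \<in> module.span free_scale (tensor_relations sA sB))"

definition tensor_grade ::
    "(bit \<Rightarrow> 'a set) \<Rightarrow> (bit \<Rightarrow> 'b set) \<Rightarrow> ('k::field \<Rightarrow> 't::ab_group_add \<Rightarrow> 't) \<Rightarrow>
     ('a \<Rightarrow> 'b \<Rightarrow> 't) \<Rightarrow> bit \<Rightarrow> 't set" where
  "tensor_grade gA gB sT tens d =
     module.span sT {tens x y | x y i j. x \<in> gA i \<and> y \<in> gB j \<and> i + j = d}"

definition is_graded_tensor_product ::
    "('k::field \<Rightarrow> 'a::ring_1 \<Rightarrow> 'a) \<Rightarrow> (bit \<Rightarrow> 'a set) \<Rightarrow>
     ('k \<Rightarrow> 'b::ring_1 \<Rightarrow> 'b) \<Rightarrow> (bit \<Rightarrow> 'b set) \<Rightarrow>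
     ('k \<Rightarrow> 't::ring_1 \<Rightarrow> 't) \<Rightarrow> ('a \<Rightarrow> 'b \<Rightarrow> 't) \<Rightarrow> bool" where
  "is_graded_tensor_product sA gA sB gB sT tens \<longleftrightarrow>
     is_tensor_product sA sB sT tens \<and>
     tens 1 1 = 1 \<and>
     (\<forall>i j k l. \<forall>x\<in>gA i. \<forall>y\<in>gB j. \<forall>x'\<in>gA k. \<forall>y'\<in>gB l.
        tens x y * tens x' y' = sT (koszul_sign j k) (tens (x * x') (y * y')))"

definition is_invertible :: "'r::ring_1 \<Rightarrow> bool" where
  "is_invertible x \<longleftrightarrow> (\<exists>y. x * y = 1 \<and> y * x = 1)"

definition inv_of :: "'r::ring_1 \<Rightarrow> 'r" where
  "inv_of x = (THE y. x * y = 1 \<and> y * x = 1)"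


section \<open>Data on a superalgebra and its second and third tensor powers\<close>

text \<open>The types \<open>'a\<close>, \<open>'b\<close>, \<open>'c\<close> carry $A$, $A\otimes A$ and
  $A\otimes A\otimes A = (A\otimes A)\otimes A$; products are the ring operations of these types.\<close>

record ('k, 'a, 'b, 'c) hopf_data =
  smult1 :: "'k \<Rightarrow> 'a \<Rightarrow> 'a"
  smult2 :: "'k \<Rightarrow> 'b \<Rightarrow> 'b"
  smult3 :: "'k \<Rightarrow> 'c \<Rightarrow> 'c"
  grade  :: "bit \<Rightarrow> 'a set"
  tens2  :: "'a \<Rightarrow> 'a \<Rightarrow> 'b"
  tens3  :: "'b \<Rightarrow> 'a \<Rightarrow> 'c"
  comult :: "'a \<Rightarrow> 'b"
  counit :: "'a \<Rightarrow> 'k"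
  antipode :: "'a \<Rightarrow> 'a"
  Rmat   :: "'b"

definition grade2 :: "('k::field, 'a::ring_1, 'b::ring_1, 'c::ring_1) hopf_data \<Rightarrow> bit \<Rightarrow> 'b set" where
  "grade2 H = tensor_grade (grade H) (grade H) (smult2 H) (tens2 H)"

text \<open>\<open>lift2 H s \<beta>\<close> is the linear map on $A\otimes A$, with values in a space with scalar
  multiplication \<open>s\<close>, that sends $a\otimes b$ to \<open>\<beta> a b\<close>.\<close>

definition lift2 :: "('k::field, 'a::ring_1, 'b::ring_1, 'c::ring_1) hopf_data \<Rightarrow>
    ('k \<Rightarrow> 'u::ab_group_add \<Rightarrow> 'u) \<Rightarrow> ('a \<Rightarrow> 'a \<Rightarrow> 'u) \<Rightarrow> 'b \<Rightarrow> 'u" where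
  "lift2 H s \<beta> = (THE L. Vector_Spaces.linear (smult2 H) s L \<and> (\<forall>a b. L (tens2 H a b) = \<beta> a b))"

text \<open>$a\otimes x$ for $x\in A\otimes A$, under $A\otimes(A\otimes A) = (A\otimes A)\otimes A$.\<close>

definition tens3' :: "('k::field, 'a::ring_1, 'b::ring_1, 'c::ring_1) hopf_data \<Rightarrow> 'a \<Rightarrow> 'b \<Rightarrow> 'c" where
  "tens3' H a = lift2 H (smult3 H) (\<lambda>b c. tens3 H (tens2 H a b) c)"

definition map_left :: "('k::field, 'a::ring_1, 'b::ring_1, 'c::ring_1) hopf_data \<Rightarrow>
    ('a \<Rightarrow> 'b) \<Rightarrow> 'b \<Rightarrow> 'c" where \<comment> \<open>$f\otimes 1$\<close>
  "map_left H f = lift2 H (smult3 H) (\<lambda>a b. tens3 H (f a) b)"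

definition map_right :: "('k::field, 'a::ring_1, 'b::ring_1, 'c::ring_1) hopf_data \<Rightarrow>
    ('a \<Rightarrow> 'b) \<Rightarrow> 'b \<Rightarrow> 'c" where \<comment> \<open>$1\otimes f$\<close>
  "map_right H f = lift2 H (smult3 H) (\<lambda>a b. tens3' H a (f b))"

definition counit_left :: "('k::field, 'a::ring_1, 'b::ring_1, 'c::ring_1) hopf_data \<Rightarrow> 'b \<Rightarrow> 'a" where
  "counit_left H = lift2 H (smult1 H) (\<lambda>a b. smult1 H (counit H a) b)"

definition counit_right :: "('k::field, 'a::ring_1, 'b::ring_1, 'c::ring_1) hopf_data \<Rightarrow> 'b \<Rightarrow> 'a" where
  "counit_right H = lift2 H (smult1 H) (\<lambda>a b. smult1 H (counit H b) a)"

definition twist :: "('k::field, 'a::ring_1, 'b::ring_1, 'c::ring_1) hopf_data \<Rightarrow> 'b \<Rightarrow> 'b" where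
  "twist H = (THE L. Vector_Spaces.linear (smult2 H) (smult2 H) L \<and>
     (\<forall>i j. \<forall>a\<in>grade H i. \<forall>b\<in>grade H j.
        L (tens2 H a b) = smult2 H (koszul_sign i j) (tens2 H b a)))"

definition twist_left :: "('k::field, 'a::ring_1, 'b::ring_1, 'c::ring_1) hopf_data \<Rightarrow> 'c \<Rightarrow> 'c" where
  \<comment> \<open>$T\otimes 1$\<close>
  "twist_left H = (THE L. Vector_Spaces.linear (smult3 H) (smult3 H) L \<and>
     (\<forall>x c. L (tens3 H x c) = tens3 H (twist H x) c))"

definition twist_right :: "('k::field, 'a::ring_1, 'b::ring_1, 'c::ring_1) hopf_data \<Rightarrow> 'c \<Rightarrow> 'c" where
  \<comment> \<open>$1\otimes T$\<close>
  "twist_right H = (THE L. Vector_Spaces.linear (smult3 H) (smult3 H) L \<and>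
     (\<forall>a x. L (tens3' H a x) = tens3' H a (twist H x)))"

definition X12 :: "('k::field, 'a::ring_1, 'b::ring_1, 'c::ring_1) hopf_data \<Rightarrow> 'b \<Rightarrow> 'c" where
  "X12 H X = tens3 H X 1"

definition X23 :: "('k::field, 'a::ring_1, 'b::ring_1, 'c::ring_1) hopf_data \<Rightarrow> 'b \<Rightarrow> 'c" where
  "X23 H X = tens3' H 1 X"

definition X13 :: "('k::field, 'a::ring_1, 'b::ring_1, 'c::ring_1) hopf_data \<Rightarrow> 'b \<Rightarrow> 'c" where
  "X13 H X = twist_right H (X12 H X)"

definition leg1 :: "('k::field, 'a::ring_1, 'b::ring_1, 'c::ring_1) hopf_data \<Rightarrow> 'a \<Rightarrow> 'c" where
  \<comment> \<open>$a^{(1)} = a\otimes 1\otimes 1$\<close>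
  "leg1 H a = tens3 H (tens2 H a 1) 1"

text \<open>\<open>perm3 H i j k\<close> is the graded permutation moving the tensor factors 1, 2, 3 to the positions
  \<open>i\<close>, \<open>j\<close>, \<open>k\<close>; e.g. \<open>perm3 H 3 1 2\<close> sends $a\otimes b\otimes c$ to $\pm b\otimes c\otimes a$.\<close>

definition perm3 :: "('k::field, 'a::ring_1, 'b::ring_1, 'c::ring_1) hopf_data \<Rightarrow>
    nat \<Rightarrow> nat \<Rightarrow> nat \<Rightarrow> 'c \<Rightarrow> 'c" where
  "perm3 H i j k =
     (if (i, j, k) = (1, 2, 3) then id
      else if (i, j, k) = (1, 3, 2) then twist_right H
      else if (i, j, k) = (2, 1, 3) then twist_left H
      else if (i, j, k) = (3, 1, 2) then twist_right H \<circ> twist_left H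
      else if (i, j, k) = (2, 3, 1) then twist_left H \<circ> twist_right H
      else if (i, j, k) = (3, 2, 1) then twist_right H \<circ> twist_left H \<circ> twist_right H
      else undefined)"

definition cyc231 :: "('k::field, 'a::ring_1, 'b::ring_1, 'c::ring_1) hopf_data \<Rightarrow> 'c \<Rightarrow> 'c" where
  "cyc231 H \<Phi> = twist_right H (twist_left H \<Phi>)"


section \<open>Quasi-triangular Hopf superalgebras\<close>

locale qt_hopf_superalgebra =
  fixes H :: "('k::field, 'a::ring_1, 'b::ring_1, 'c::ring_1) hopf_data"
  assumes superalgebra: "superalgebra (smult1 H) (grade H)"
    and tensor2: "is_graded_tensor_product (smult1 H) (grade H) (smult1 H) (grade H)
          (smult2 H) (tens2 H)"
    and tensor3: "is_graded_tensor_product (smult2 H) (grade2 H) (smult1 H) (grade H)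
          (smult3 H) (tens3 H)"
    and comult_linear: "Vector_Spaces.linear (smult1 H) (smult2 H) (comult H)"
    and comult_one: "comult H 1 = 1"
    and comult_mult: "comult H (a * b) = comult H a * comult H b"
    and comult_grade: "a \<in> grade H i \<Longrightarrow> comult H a \<in> grade2 H i"
    and counit_linear: "Vector_Spaces.linear (smult1 H) (*) (counit H)"
    and counit_one: "counit H 1 = 1"
    and counit_mult: "counit H (a * b) = counit H a * counit H b"
    and counit_grade: "a \<in> grade H 1 \<Longrightarrow> counit H a = 0"
    and antipode_linear: "Vector_Spaces.linear (smult1 H) (smult1 H) (antipode H)"
    and antipode_one: "antipode H 1 = 1"
    and antipode_mult: "a \<in> grade H i \<Longrightarrow> b \<in> grade H j \<Longrightarrow>
          antipode H (a * b) = smult1 H (koszul_sign i j) (antipode H b * antipode H a)"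
    and antipode_grade: "a \<in> grade H i \<Longrightarrow> antipode H a \<in> grade H i"
    and coassoc: "map_left H (comult H) (comult H a) = map_right H (comult H) (comult H a)"
    and counit_left: "counit_left H (comult H a) = a"
    and counit_right: "counit_right H (comult H a) = a"
    and antipode_left:
      "lift2 H (smult1 H) (\<lambda>x y. antipode H x * y) (comult H a) = smult1 H (counit H a) 1"
    and antipode_right:
      "lift2 H (smult1 H) (\<lambda>x y. x * antipode H y) (comult H a) = smult1 H (counit H a) 1"
    and R_invertible: "is_invertible (Rmat H)"
    and R_homogeneous: "\<exists>d. Rmat H \<in> grade2 H d"
    and R_intertwines: "twist H (comult H a) * Rmat H = Rmat H * comult H a"
    and R_left: "map_left H (comult H) (Rmat H) = X13 H (Rmat H) * X23 H (Rmat H)"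
    and R_right: "map_right H (comult H) (Rmat H) = X13 H (Rmat H) * X12 H (Rmat H)"

definition twistor :: "('k::field, 'a::ring_1, 'b::ring_1, 'c::ring_1) hopf_data \<Rightarrow> 'b \<Rightarrow> bool" where
  "twistor H F \<longleftrightarrow> is_invertible F \<and> (\<exists>d. F \<in> grade2 H d) \<and>
     counit_left H F = 1 \<and> counit_right H F = 1"

definition twisted_comult :: "('k::field, 'a::ring_1, 'b::ring_1, 'c::ring_1) hopf_data \<Rightarrow>
    'b \<Rightarrow> 'a \<Rightarrow> 'b" where
  "twisted_comult H F a = F * comult H a * inv_of F"

definition twisted_R :: "('k::field, 'a::ring_1, 'b::ring_1, 'c::ring_1) hopf_data \<Rightarrow> 'b \<Rightarrow> 'b" where
  "twisted_R H F = twist H F * Rmat H * inv_of F"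

definition twisted_coassociator ::
    "('k::field, 'a::ring_1, 'b::ring_1, 'c::ring_1) hopf_data \<Rightarrow> 'b \<Rightarrow> 'c" where
  "twisted_coassociator H F =
     X12 H F * map_left H (comult H) F * map_right H (comult H) (inv_of F) * inv_of (X23 H F)"


section \<open>Shifting the parameters\<close>

text \<open>The parameter $\lambda = \sum_l \lambda_l h^l$ is recorded by its components
  \<open>lam :: 'l \<Rightarrow> 'k\<close>, which range over a domain \<open>D\<close> (so that poles are allowed), and the shift by
  $h$ by the even elements \<open>h l\<close> $= h_l$ of $A$.  Replacing each $\lambda_l$ by
  $\lambda_l + h_l^{(1)}$ has no direct meaning for an arbitrary function of $\lambda$.  Therefore
  \<open>\<F>\<close> is a unital algebra of admissible functions from \<open>D\<close> to $A\otimes A$ that contains the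
  constants and the parameters, and \<open>\<sigma> lam f\<close>, to be read $f_{23}(\lambda + h^{(1)})$, is the
  result of the substitution: an algebra homomorphism on \<open>\<F>\<close> that sends a constant $X$ to
  $X_{23}$ and the parameter $\lambda_l$ to $\lambda_l + h_l^{(1)}$.  These conditions determine
  \<open>\<sigma>\<close> on polynomial functions, and on the inverses of such functions in \<open>\<F>\<close>.\<close>

locale parameter_shift =
  fixes H :: "('k::field, 'a::ring_1, 'b::ring_1, 'c::ring_1) hopf_data"
    and D :: "('l::finite \<Rightarrow> 'k) set"
    and h :: "'l \<Rightarrow> 'a"
    and \<F> :: "(('l \<Rightarrow> 'k) \<Rightarrow> 'b) set"
    and \<sigma> :: "('l \<Rightarrow> 'k) \<Rightarrow> (('l \<Rightarrow> 'k) \<Rightarrow> 'b) \<Rightarrow> 'c"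
  assumes h_even: "h l \<in> grade H 0"
    and const_mem: "(\<lambda>_. X) \<in> \<F>"
    and param_mem: "(\<lambda>\<mu>. smult2 H (\<mu> l) 1) \<in> \<F>"
    and add_mem: "f \<in> \<F> \<Longrightarrow> g \<in> \<F> \<Longrightarrow> (\<lambda>\<mu>. f \<mu> + g \<mu>) \<in> \<F>"
    and mult_mem: "f \<in> \<F> \<Longrightarrow> g \<in> \<F> \<Longrightarrow> (\<lambda>\<mu>. f \<mu> * g \<mu>) \<in> \<F>"
    and shift_cong: "lam \<in> D \<Longrightarrow> f \<in> \<F> \<Longrightarrow> g \<in> \<F> \<Longrightarrow> (\<And>\<mu>. \<mu> \<in> D \<Longrightarrow> f \<mu> = g \<mu>) \<Longrightarrow>
          \<sigma> lam f = \<sigma> lam g"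
    and shift_const: "lam \<in> D \<Longrightarrow> \<sigma> lam (\<lambda>_. X) = X23 H X"
    and shift_param: "lam \<in> D \<Longrightarrow>
          \<sigma> lam (\<lambda>\<mu>. smult2 H (\<mu> l) 1) = smult3 H (lam l) 1 + leg1 H (h l)"
    and shift_add: "lam \<in> D \<Longrightarrow> f \<in> \<F> \<Longrightarrow> g \<in> \<F> \<Longrightarrow>
          \<sigma> lam (\<lambda>\<mu>. f \<mu> + g \<mu>) = \<sigma> lam f + \<sigma> lam g"
    and shift_mult: "lam \<in> D \<Longrightarrow> f \<in> \<F> \<Longrightarrow> g \<in> \<F> \<Longrightarrow>
          \<sigma> lam (\<lambda>\<mu>. f \<mu> * g \<mu>) = \<sigma> lam f * \<sigma> lam g"

text \<open>In the following \<open>G\<close> stands for $F_{23}(\lambda + h^{(1)})$; then \<open>shifted_F H G i j k\<close> is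
  $F_{jk}(\lambda + h^{(i)})$ and \<open>shifted_R12\<close>, \<open>shifted_R13\<close>, \<open>shifted_R23\<close> are
  $R_{12}(\lambda + h^{(3)})$, $R_{13}(\lambda + h^{(2)})$, $R_{23}(\lambda + h^{(1)})$.\<close>

definition shifted_F :: "('k::field, 'a::ring_1, 'b::ring_1, 'c::ring_1) hopf_data \<Rightarrow> 'c \<Rightarrow>
    nat \<Rightarrow> nat \<Rightarrow> nat \<Rightarrow> 'c" where
  "shifted_F H G i j k = perm3 H i j k G"

definition shifted_R12 :: "('k::field, 'a::ring_1, 'b::ring_1, 'c::ring_1) hopf_data \<Rightarrow> 'c \<Rightarrow> 'c" where
  "shifted_R12 H G = shifted_F H G 3 2 1 * X12 H (Rmat H) * inv_of (shifted_F H G 3 1 2)"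

definition shifted_R13 :: "('k::field, 'a::ring_1, 'b::ring_1, 'c::ring_1) hopf_data \<Rightarrow> 'c \<Rightarrow> 'c" where
  "shifted_R13 H G = shifted_F H G 2 3 1 * X13 H (Rmat H) * inv_of (shifted_F H G 2 1 3)"

definition shifted_R23 :: "('k::field, 'a::ring_1, 'b::ring_1, 'c::ring_1) hopf_data \<Rightarrow> 'c \<Rightarrow> 'c" where
  "shifted_R23 H G = shifted_F H G 1 3 2 * X23 H (Rmat H) * inv_of (shifted_F H G 1 2 3)"

definition shifted_cocycle :: "('k::field, 'a::ring_1, 'b::ring_1, 'c::ring_1) hopf_data \<Rightarrow>
    ('l::finite \<Rightarrow> 'k) set \<Rightarrow> (('l \<Rightarrow> 'k) \<Rightarrow> (('l \<Rightarrow> 'k) \<Rightarrow> 'b) \<Rightarrow> 'c) \<Rightarrow> (('l \<Rightarrow> 'k) \<Rightarrow> 'b) \<Rightarrow> bool" where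
  "shifted_cocycle H D \<sigma> F \<longleftrightarrow>
     (\<forall>lam\<in>D. X12 H (F lam) * map_left H (comult H) (F lam)
             = \<sigma> lam F * map_right H (comult H) (F lam))"

end

theory Submission
  imports Defs
begin

text \<open>
  The third tensor power carries the two graded transpositions of neighbouring legs, the leg
  embeddings, and $\Delta\otimes1$ and $1\otimes\Delta$.  All of them are multiplicative, the
  transpositions satisfy the relations of the symmetric group, and a cyclic permutation carries
  $(1\otimes\Delta)x$ to $(\Delta\otimes1)x^T$.  Moreover $\mathcal R_{12}$ and $\mathcal R_{23}$
  intertwine the coproducts with their transposes.  Once this calculus is available
  (\<open>twist_left_hom\<close> and its companions, \<open>cycle_comult_right\<close>, \<open>R12_intertwines\<close>,
  \<open>R23_intertwines\<close>), the theorem is a computation in a noncommutative ring.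

  Write $G=F_{23}(\lambda+h^{(1)})$.  The cocycle identity
  $F_{12}\cdot(\Delta\otimes1)F=G\cdot(1\otimes\Delta)F$ immediately gives
  $\Phi=G\,F_{23}^{-1}$, and it makes $G$ invertible.  Permuting its legs gives further
  identities for the other shifted elements.  In the two coproduct formulas
  (\<open>left_coproduct_twisted_R\<close>, \<open>right_coproduct_twisted_R\<close>) these replace one
  coproduct of $F^{-1}$ by the other whenever that is the one which can be moved past the next
  $\mathcal R_{ij}$.  For the dynamical Yang--Baxter equation (\<open>dynamical_yang_baxter\<close>) the two
  formulas turn each side into a product of the three $\mathcal R_{ij}$ with images of $F$ and
  $G$; the reversed cocycle identity and the ordinary Yang--Baxter equation identify these
  products.

  Besides the rules of this calculus, signs matter at one point: $\mathcal R$ and $F$ must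
  be even, for they are moved past the remaining leg.  A homogeneous element $x$ with
  $(\epsilon\otimes1)x=1$ is even, since $\epsilon$ kills odd elements (\<open>even_if_counit_left_one\<close>).  This applies to $F$ by
  assumption, and to $\mathcal R$ because $(\epsilon\otimes1)\mathcal R=1$ follows from its
  coproduct and its invertibility (\<open>counit_left_R\<close>).

  The maps involved are given by definite descriptions.  They exist and are unique by the universal
  property of the tensor product (\<open>tensor_product_lift\<close>), and identities between them are
  verified on homogeneous pure tensors, which span additively.
\<close>

section \<open>The universal property of the tensor product\<close>

definition bilinear_map ::
    "('k::field \<Rightarrow> 'a::ab_group_add \<Rightarrow> 'a) \<Rightarrow> ('k \<Rightarrow> 'b::ab_group_add \<Rightarrow> 'b) \<Rightarrow>
     ('k \<Rightarrow> 'u::ab_group_add \<Rightarrow> 'u) \<Rightarrow> ('a \<Rightarrow> 'b \<Rightarrow> 'u) \<Rightarrow> bool" where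
  "bilinear_map sA sB sU \<beta> \<longleftrightarrow>
     (\<forall>y. Vector_Spaces.linear sA sU (\<lambda>x. \<beta> x y)) \<and> (\<forall>x. Vector_Spaces.linear sB sU (\<beta> x))"

lemma bilinear_mapI:
  assumes "vector_space sA" "vector_space sB" "vector_space sU"
    and "\<And>x x' y. \<beta> (x + x') y = \<beta> x y + \<beta> x' y"
    and "\<And>x y y'. \<beta> x (y + y') = \<beta> x y + \<beta> x y'"
    and "\<And>c x y. \<beta> (sA c x) y = sU c (\<beta> x y)"
    and "\<And>c x y. \<beta> x (sB c y) = sU c (\<beta> x y)"
  shows "bilinear_map sA sB sU \<beta>"
  using assms by (simp add: bilinear_map_def Vector_Spaces.linear_iff)

lemma bilinear_mapD:
  assumes "bilinear_map sA sB sU \<beta>"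
  shows "\<beta> (x + x') y = \<beta> x y + \<beta> x' y" "\<beta> x (y + y') = \<beta> x y + \<beta> x y'"
    "\<beta> (sA c x) y = sU c (\<beta> x y)" "\<beta> x (sB c y) = sU c (\<beta> x y)"
    "\<beta> 0 y = 0" "\<beta> x 0 = 0"
proof -
  show add: "\<beta> (x + x') y = \<beta> x y + \<beta> x' y" "\<beta> x (y + y') = \<beta> x y + \<beta> x y'" for x x' y y'
    using assms by (auto simp: bilinear_map_def Vector_Spaces.linear_iff)
  show "\<beta> (sA c x) y = sU c (\<beta> x y)" "\<beta> x (sB c y) = sU c (\<beta> x y)"
    using assms by (auto simp: bilinear_map_def Vector_Spaces.linear_iff)
  show "\<beta> 0 y = 0" "\<beta> x 0 = 0"
    using add(1)[of 0 0 y] add(2)[of x 0 0] by auto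
qed

lemma lookup_free_scale: "Poly_Mapping.lookup (free_scale c f) p = c * Poly_Mapping.lookup f p"
  by (simp add: free_scale_def Poly_Mapping.map.rep_eq when_def)

lemma vector_space_free_scale: "vector_space free_scale"
  by standard (auto intro!: poly_mapping_eqI simp: lookup_free_scale lookup_add algebra_simps)

lemma tensor_eval_superset:
  assumes "vector_space s" "finite S" "Poly_Mapping.keys f \<subseteq> S"
  shows "tensor_eval s \<beta> f = (\<Sum>p\<in>S. s (Poly_Mapping.lookup f p) (\<beta> (fst p) (snd p)))"
proof -
  interpret vector_space s by fact
  show ?thesis
    unfolding tensor_eval_def
    by (rule sum.mono_neutral_left) (use assms in \<open>auto simp: in_keys_iff\<close>)
qed

lemma linear_tensor_eval:
  assumes "vector_space s"
  shows "Vector_Spaces.linear free_scale s (tensor_eval s \<beta>)"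
proof -
  interpret vector_space s by fact
  have add: "tensor_eval s \<beta> (f + g) = tensor_eval s \<beta> f + tensor_eval s \<beta> g" for f g
  proof -
    let ?S = "Poly_Mapping.keys f \<union> Poly_Mapping.keys g"
    have "Poly_Mapping.keys (f + g) \<subseteq> ?S" by (rule Poly_Mapping.keys_add)
    then show ?thesis
      by (simp add: tensor_eval_superset[OF assms, of ?S] lookup_add scale_left_distrib sum.distrib)
  qed
  have scale: "tensor_eval s \<beta> (free_scale c f) = s c (tensor_eval s \<beta> f)" for c f
  proof -
    have "Poly_Mapping.keys (free_scale c f) \<subseteq> Poly_Mapping.keys f"
      by (auto simp: in_keys_iff lookup_free_scale)
    then show ?thesis
      by (simp add: tensor_eval_superset[OF assms, of "Poly_Mapping.keys f"] lookup_free_scale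
          scale_sum_right)
  qed
  show ?thesis
    using add scale by (simp add: Vector_Spaces.linear_iff vector_space_free_scale assms)
qed

lemma tensor_eval_single:
  assumes "vector_space s"
  shows "tensor_eval s \<beta> (Poly_Mapping.single (x, y) c) = s c (\<beta> x y)"
  by (simp add: tensor_eval_superset[OF assms, of "{(x, y)}"])

lemma tensor_eval_relations:
  assumes "vector_space sU" "bilinear_map sA sB sU \<beta>" "r \<in> tensor_relations sA sB"
  shows "tensor_eval sU \<beta> r = 0"
proof -
  interpret vector_space sU by fact
  interpret E: Vector_Spaces.linear free_scale sU "tensor_eval sU \<beta>" by (rule linear_tensor_eval) fact
  show ?thesis
    using assms(3)
    by cases (simp_all add: E.diff tensor_eval_single[OF assms(1)] bilinear_mapD[OF assms(2)])
qed

text \<open>The generators of \<open>tensor_relations\<close> lie in the kernel of the evaluation map, which says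
  that the four bilinearity identities hold for \<open>tens\<close>.\<close>

lemma bilinear_tensor:
  assumes "is_tensor_product sA sB sT tens"
  shows "bilinear_map sA sB sT tens"
proof -
  have vs: "vector_space sA" "vector_space sB" "vector_space sT"
    and ker: "\<And>f. tensor_eval sT tens f = 0 \<longleftrightarrow> f \<in> module.span free_scale (tensor_relations sA sB)"
    using assms by (auto simp: is_tensor_product_def)
  interpret T: vector_space sT by fact
  interpret V: vector_space free_scale by (rule vector_space_free_scale)
  interpret E: Vector_Spaces.linear free_scale sT "tensor_eval sT tens" by (rule linear_tensor_eval) fact
  have zero: "tensor_eval sT tens r = 0" if "r \<in> tensor_relations sA sB" for r
    using that by (simp add: ker V.span_base)
  note ev = E.diff E.add tensor_eval_single[OF vs(3)]
  show ?thesis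
    using zero[OF tensor_relations.intros(1)] zero[OF tensor_relations.intros(2)]
      zero[OF tensor_relations.intros(3)] zero[OF tensor_relations.intros(4)]
    by (intro bilinear_mapI vs) (simp_all add: ev algebra_simps)
qed

text \<open>Scalars can be absorbed into the left factor, so pure tensors span additively, and no step for
  scalar multiples is needed.  All identities between additive maps below are proved by this
  induction or its homogeneous refinements.\<close>

lemma tensor_product_induct [consumes 1, case_names pure add]:
  assumes "is_tensor_product sA sB sT tens"
    and pure: "\<And>x y. P (tens x y)"
    and add: "\<And>u v. P u \<Longrightarrow> P v \<Longrightarrow> P (u + v)"
  shows "P z"
proof -
  have vs: "vector_space sA" "vector_space sT" and "surj (tensor_eval sT tens)"
    using assms(1) by (auto simp: is_tensor_product_def)
  then obtain f where z: "z = tensor_eval sT tens f" by (metis surjD)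
  note bil = bilinear_tensor[OF assms(1)]
  have "P (\<Sum>p\<in>S. sT (Poly_Mapping.lookup f p) (tens (fst p) (snd p)))" if "finite S" for S
    using that
  proof induction
    case empty
    show ?case using pure[of 0 0] by (simp add: bilinear_mapD[OF bil])
  next
    case (insert p S)
    then show ?case by (simp add: bilinear_mapD(3)[OF bil, symmetric] add pure)
  qed
  then show ?thesis by (simp add: z tensor_eval_def)
qed

text \<open>Evaluation of formal sums along \<open>\<beta>\<close> kills the bilinearity relations, which span the kernel of
  the evaluation along \<open>tens\<close>; hence it factors through the latter.  This is what makes the
  definite descriptions behind \<open>lift2\<close>, \<open>twist\<close>, \<open>twist_left\<close> and \<open>twist_right\<close>
  meaningful.\<close>

lemma tensor_product_lift:
  assumes "is_tensor_product sA sB sT tens" and "bilinear_map sA sB sU \<beta>" and "vector_space sU"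
  shows "\<exists>!L. Vector_Spaces.linear sT sU L \<and> (\<forall>x y. L (tens x y) = \<beta> x y)"
proof (rule ex_ex1I)
  have vs: "vector_space sA" "vector_space sB" "vector_space sT"
    and surj: "surj (tensor_eval sT tens)"
    and ker: "\<And>f. tensor_eval sT tens f = 0 \<longleftrightarrow> f \<in> module.span free_scale (tensor_relations sA sB)"
    using assms(1) by (auto simp: is_tensor_product_def)
  interpret U: vector_space sU by fact
  interpret V: vector_space free_scale by (rule vector_space_free_scale)
  interpret T: Vector_Spaces.linear free_scale sT "tensor_eval sT tens" by (rule linear_tensor_eval) fact
  interpret E: Vector_Spaces.linear free_scale sU "tensor_eval sU \<beta>" by (rule linear_tensor_eval) fact
  have "tensor_eval sU \<beta> f = 0" if "tensor_eval sT tens f = 0" for f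
    using that unfolding ker
    by (rule E.eq_0_on_span[rotated]) (rule tensor_eval_relations[OF assms(3,2)])
  then have kernel: "tensor_eval sU \<beta> f = tensor_eval sU \<beta> g"
    if "tensor_eval sT tens f = tensor_eval sT tens g" for f g
    using that by (metis E.diff T.diff right_minus_eq)
  define L where "L t = tensor_eval sU \<beta> (inv (tensor_eval sT tens) t)" for t
  have L: "L (tensor_eval sT tens f) = tensor_eval sU \<beta> f" for f
    unfolding L_def by (rule kernel) (simp add: surj surj_f_inv_f)
  have "L (x + y) = L x + L y" for x y
  proof -
    obtain f g where "x = tensor_eval sT tens f" "y = tensor_eval sT tens g"
      using surj by (metis surjD)
    then show ?thesis by (metis L E.add T.add)
  qed
  moreover have "L (sT c x) = sU c (L x)" for c x
  proof -
    obtain f where "x = tensor_eval sT tens f" using surj by (metis surjD)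
    then show ?thesis by (metis L E.scale T.scale)
  qed
  moreover have "L (tens x y) = \<beta> x y" for x y
    using L[of "Poly_Mapping.single (x, y) 1"] vs assms(3)
    by (simp add: tensor_eval_single T.vs2.scale_one)
  ultimately show "\<exists>L. Vector_Spaces.linear sT sU L \<and> (\<forall>x y. L (tens x y) = \<beta> x y)"
    using vs assms(3) by (intro exI[of _ L]) (simp add: Vector_Spaces.linear_iff)
next
  fix L L'
  assume L: "Vector_Spaces.linear sT sU L \<and> (\<forall>x y. L (tens x y) = \<beta> x y)"
    and L': "Vector_Spaces.linear sT sU L' \<and> (\<forall>x y. L' (tens x y) = \<beta> x y)"
  have "L z = L' z" for z
    using assms(1) L L'
    by (induction z rule: tensor_product_induct) (auto simp: Vector_Spaces.linear_iff)
  then show "L = L'" by blast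
qed

section \<open>Signs and homogeneous parts\<close>

lemma bit_zero_or_one: "(i::bit) = 0 \<or> i = 1"
  by (cases i) auto

lemma koszul_sign_simps:
  "koszul_sign 0 j = 1" "koszul_sign i 0 = 1"
  "koszul_sign (i + j) k = koszul_sign i k * koszul_sign j k"
  "koszul_sign i (j + k) = koszul_sign i j * koszul_sign i k"
  by (cases i; cases j; cases k; simp add: koszul_sign_def)+

lemma koszul_sign_commute: "koszul_sign i j = koszul_sign j i"
  by (simp add: koszul_sign_def mult.commute)

lemma koszul_sign_square:
  "koszul_sign i j * koszul_sign i j = 1" "koszul_sign i j * (koszul_sign i j * x) = x"
  by (simp_all add: koszul_sign_def)

context superalgebra
begin

lemma homogeneous_induct [case_names homogeneous add]:
  assumes "\<And>i x. x \<in> grd i \<Longrightarrow> P x" and "\<And>x y. P x \<Longrightarrow> P y \<Longrightarrow> P (x + y)"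
  shows "P x"
  using grd_decomp[of x] assms by blast

text \<open>The projection onto the odd part is linear, so it can occur in bilinear maps that depend on
  degrees, which are otherwise specified on homogeneous elements only.\<close>

definition odd_part :: "'a \<Rightarrow> 'a" where
  "odd_part x = (THE y. y \<in> grd 1 \<and> x - y \<in> grd 0)"

lemma odd_part_eqI:
  assumes "y \<in> grd 1" "x - y \<in> grd 0"
  shows "odd_part x = y"
  unfolding odd_part_def
proof (rule the_equality)
  show "y \<in> grd 1 \<and> x - y \<in> grd 0" using assms by blast
next
  fix z assume z: "z \<in> grd 1 \<and> x - z \<in> grd 0"
  have "z - y \<in> grd 1" using z assms subspace_diff[OF subspace_grd] by blast
  moreover have "(x - y) - (x - z) \<in> grd 0" using z assms subspace_diff[OF subspace_grd] by blast
  ultimately have "z - y \<in> grd 0 \<inter> grd 1" by simp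
  then show "z = y" by (simp add: grd_disjoint)
qed

lemma odd_part: "odd_part x \<in> grd 1" "x - odd_part x \<in> grd 0"
proof -
  obtain x0 x1 where x: "x0 \<in> grd 0" "x1 \<in> grd 1" "x = x0 + x1"
    using grd_decomp[of x] by blast
  then have "odd_part x = x1" by (intro odd_part_eqI) auto
  then show "odd_part x \<in> grd 1" "x - odd_part x \<in> grd 0" using x by auto
qed

lemma odd_part_linear:
  "odd_part (x + y) = odd_part x + odd_part y" "odd_part (scale c x) = scale c (odd_part x)"
proof -
  have "odd_part x + odd_part y \<in> grd 1"
    by (intro subspace_add[OF subspace_grd] odd_part)
  moreover have "(x - odd_part x) + (y - odd_part y) \<in> grd 0"
    by (intro subspace_add[OF subspace_grd] odd_part)
  ultimately show "odd_part (x + y) = odd_part x + odd_part y"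
    by (intro odd_part_eqI) (simp_all add: algebra_simps)
  have "scale c (odd_part x) \<in> grd 1"
    by (intro subspace_scale[OF subspace_grd] odd_part)
  moreover have "scale c (x - odd_part x) \<in> grd 0"
    by (intro subspace_scale[OF subspace_grd] odd_part)
  ultimately show "odd_part (scale c x) = scale c (odd_part x)"
    by (intro odd_part_eqI) (simp_all add: scale_right_diff_distrib)
qed

lemma odd_part_homogeneous: "x \<in> grd i \<Longrightarrow> odd_part x = (if i = 1 then x else 0)"
  using bit_zero_or_one[of i] subspace_0[OF subspace_grd] by (auto intro!: odd_part_eqI)

end

section \<open>Unital multiplicative maps and inverses\<close>

definition unital_hom :: "('r::ring_1 \<Rightarrow> 's::ring_1) \<Rightarrow> bool" where
  "unital_hom f \<longleftrightarrow> f 1 = 1 \<and> (\<forall>x y. f (x * y) = f x * f y)"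

lemma inv_of_eqI:
  assumes "x * y = 1" "y * x = 1"
  shows "inv_of x = y"
  unfolding inv_of_def
proof (rule the_equality)
  fix z assume "x * z = 1 \<and> z * x = 1"
  then show "z = y" using assms by (metis mult.assoc mult.left_neutral mult.right_neutral)
qed (use assms in blast)

lemma inv_of:
  assumes "is_invertible x"
  shows "x * inv_of x = 1" "inv_of x * x = 1"
  using assms inv_of_eqI unfolding is_invertible_def by metis+

lemma unital_hom_mult: "unital_hom f \<Longrightarrow> f (x * y) = f x * f y"
  by (simp add: unital_hom_def)

lemma unital_hom_inverse:
  assumes "unital_hom f" "x * y = 1"
  shows "f x * f y = 1"
  using assms by (metis unital_hom_def)

lemma is_invertible_mult: "is_invertible x \<Longrightarrow> is_invertible y \<Longrightarrow> is_invertible (x * y)"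
  unfolding is_invertible_def by (metis mult.assoc mult.left_neutral)

lemma is_invertible_hom: "unital_hom f \<Longrightarrow> is_invertible x \<Longrightarrow> is_invertible (f x)"
  unfolding is_invertible_def using unital_hom_inverse by metis

lemma is_invertible_inv_of: "is_invertible x \<Longrightarrow> is_invertible (inv_of x)"
  using inv_of unfolding is_invertible_def by metis

lemma inv_of_mult:
  assumes "is_invertible x" "is_invertible y"
  shows "inv_of (x * y) = inv_of y * inv_of x"
proof (rule inv_of_eqI)
  have "x * (y * inv_of y) * inv_of x = 1" "inv_of y * (inv_of x * x) * y = 1"
    by (simp_all add: inv_of assms)
  then show "x * y * (inv_of y * inv_of x) = 1" "inv_of y * inv_of x * (x * y) = 1"
    by (simp_all only: mult.assoc)
qed

lemma inv_of_hom:
  assumes "unital_hom f" "is_invertible x"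
  shows "inv_of (f x) = f (inv_of x)"
  by (rule inv_of_eqI) (simp_all add: unital_hom_inverse assms inv_of)

lemma inv_of_inv_of: "is_invertible x \<Longrightarrow> inv_of (inv_of x) = x"
  by (rule inv_of_eqI) (simp_all add: inv_of)

lemma mult_prefix: "x * y = z \<Longrightarrow> x * (y * w) = z * (w :: 'r::ring_1)"
  by (simp add: mult.assoc[symmetric])

section \<open>Calculus in the second and third tensor powers\<close>

context qt_hopf_superalgebra
begin

interpretation A: superalgebra "smult1 H" "grade H"
  by (rule superalgebra)

lemma is_tensor_product2: "is_tensor_product (smult1 H) (smult1 H) (smult2 H) (tens2 H)"
  using tensor2 by (simp add: is_graded_tensor_product_def)

lemma is_tensor_product3: "is_tensor_product (smult2 H) (smult1 H) (smult3 H) (tens3 H)"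
  using tensor3 by (simp add: is_graded_tensor_product_def)

lemma vector_spaces: "vector_space (smult1 H)" "vector_space (smult2 H)" "vector_space (smult3 H)"
  using is_tensor_product2 is_tensor_product3 by (simp_all add: is_tensor_product_def)

interpretation V2: vector_space "smult2 H" by (rule vector_spaces)
interpretation V3: vector_space "smult3 H" by (rule vector_spaces)

lemmas tens2_simps = bilinear_mapD[OF bilinear_tensor[OF is_tensor_product2]]
lemmas tens3_simps = bilinear_mapD[OF bilinear_tensor[OF is_tensor_product3]]

lemma tens_one: "tens2 H 1 1 = 1" "tens3 H 1 1 = 1"
  using tensor2 tensor3 by (simp_all add: is_graded_tensor_product_def)

lemma grade_scale: "a \<in> grade H i \<Longrightarrow> smult1 H c a \<in> grade H i"
  by (rule A.subspace_scale[OF A.subspace_grd])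

lemma grade_zero: "0 \<in> grade H i"
  by (rule A.subspace_0[OF A.subspace_grd])

lemma tensor2_induct [case_names pure add]:
  assumes pure: "\<And>a b i j. a \<in> grade H i \<Longrightarrow> b \<in> grade H j \<Longrightarrow> P (tens2 H a b)"
    and add: "\<And>x y. P x \<Longrightarrow> P y \<Longrightarrow> P (x + y)"
  shows "P x"
proof (induction x rule: tensor_product_induct[OF is_tensor_product2])
  case (1 a b)
  show ?case
  proof (induction a rule: A.homogeneous_induct)
    case (homogeneous i a)
    then show ?case
      by (induction b rule: A.homogeneous_induct) (auto simp: tens2_simps pure add)
  qed (simp add: tens2_simps add)
qed (rule add)

lemma tensor3_induct [case_names pure add]:
  assumes pure: "\<And>a b c i j k. a \<in> grade H i \<Longrightarrow> b \<in> grade H j \<Longrightarrow> c \<in> grade H k \<Longrightarrow>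
      P (tens3 H (tens2 H a b) c)"
    and add: "\<And>x y. P x \<Longrightarrow> P y \<Longrightarrow> P (x + y)"
  shows "P x"
proof (induction x rule: tensor_product_induct[OF is_tensor_product3])
  case (1 X c)
  show ?case
  proof (induction c rule: A.homogeneous_induct)
    case (homogeneous i c)
    then show ?case
      by (induction X rule: tensor2_induct) (auto simp: tens3_simps pure add)
  qed (simp add: tens3_simps add)
qed (rule add)

lemma grade2_induct [consumes 1, case_names pure add]:
  assumes "x \<in> grade2 H d"
    and pure: "\<And>a b i j. a \<in> grade H i \<Longrightarrow> b \<in> grade H j \<Longrightarrow> i + j = d \<Longrightarrow> P (tens2 H a b)"
    and add: "\<And>x y. P x \<Longrightarrow> P y \<Longrightarrow> P (x + y)"
  shows "P x"
  using assms(1) unfolding grade2_def tensor_grade_def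
proof (induction rule: V2.span_induct_alt)
  case base
  show ?case using pure[of 0 0 0 d] grade_zero by (simp add: tens2_simps)
next
  case (step c x y)
  then obtain a b i j where x: "x = tens2 H a b" "a \<in> grade H i" "b \<in> grade H j" "i + j = d"
    by blast
  then have "P (smult2 H c x)"
    using pure[of "smult1 H c a" i b j] grade_scale by (simp add: tens2_simps)
  then show ?case using step by (intro add)
qed

lemma tens2_grade: "a \<in> grade H i \<Longrightarrow> b \<in> grade H j \<Longrightarrow> tens2 H a b \<in> grade2 H (i + j)"
  unfolding grade2_def tensor_grade_def by (rule V2.span_base) blast

lemma tens2_mult:
  assumes "a \<in> grade H i" "b \<in> grade H j" "a' \<in> grade H k" "b' \<in> grade H l"
  shows "tens2 H a b * tens2 H a' b' = smult2 H (koszul_sign j k) (tens2 H (a * a') (b * b'))"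
  using tensor2 assms unfolding is_graded_tensor_product_def by blast

text \<open>The sign depends only on \<open>c\<close> and \<open>y\<close>, which move past each other; bilinearity extends
  the product rule in the other two arguments.\<close>

lemma tens3_mult_graded:
  assumes "c \<in> grade H j" "y \<in> grade2 H k"
  shows "tens3 H x c * tens3 H y c' = smult3 H (koszul_sign j k) (tens3 H (x * y) (c * c'))"
proof (induction c' rule: A.homogeneous_induct)
  case (homogeneous l c')
  show ?case
  proof (induction x rule: tensor2_induct)
    case (pure a b p q)
    then show ?case
      using tensor3 assms homogeneous tens2_grade[OF pure] unfolding is_graded_tensor_product_def
      by blast
  qed (simp_all add: tens3_simps distrib_right V3.scale_right_distrib)
qed (simp_all add: tens3_simps distrib_left V3.scale_right_distrib)

lemma smult2_mult: "smult2 H c x * y = smult2 H c (x * y)" "x * smult2 H c y = smult2 H c (x * y)"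
proof -
  have "smult2 H c x * y = smult2 H c (x * y) \<and> x * smult2 H c y = smult2 H c (x * y)"
  proof (induction x rule: tensor2_induct)
    case (pure a b i j)
    show ?case
    proof (induction y rule: tensor2_induct)
      case (pure a' b' k l)
      with \<open>a \<in> grade H i\<close> \<open>b \<in> grade H j\<close> grade_scale show ?case
        by (simp add: tens2_simps(3)[symmetric] tens2_mult[of _ i _ j _ k _ l] A.scale_mult_left
            A.scale_mult_right)
          (simp add: tens2_simps V2.scale_left_commute)
    qed (simp add: distrib_left V2.scale_right_distrib)
  qed (simp add: distrib_right V2.scale_right_distrib)
  then show "smult2 H c x * y = smult2 H c (x * y)" "x * smult2 H c y = smult2 H c (x * y)"
    by auto
qed

lemma tens3_pure_mult:
  assumes "a \<in> grade H i" "b \<in> grade H j" "c \<in> grade H k"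
    "a' \<in> grade H i'" "b' \<in> grade H j'" "c' \<in> grade H k'"
  shows "tens3 H (tens2 H a b) c * tens3 H (tens2 H a' b') c' =
    smult3 H (koszul_sign j i' * koszul_sign k i' * koszul_sign k j')
      (tens3 H (tens2 H (a * a') (b * b')) (c * c'))"
  using assms
  by (simp add: tens3_mult_graded[OF _ tens2_grade, of c k a' i' b' j', unfolded koszul_sign_simps]
      tens2_mult[of a i b j a' i' b' j'] tens3_simps mult_ac)

lemma smult3_mult: "smult3 H c x * y = smult3 H c (x * y)" "x * smult3 H c y = smult3 H c (x * y)"
proof -
  have "smult3 H c x * y = smult3 H c (x * y) \<and> x * smult3 H c y = smult3 H c (x * y)"
  proof (induction x rule: tensor3_induct)
    case (pure a b d i j k)
    note x = pure
    show ?case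
    proof (induction y rule: tensor3_induct)
      case (pure a' b' d' i' j' k')
      with x grade_scale show ?case
        by (simp add: tens3_simps(4)[symmetric] tens3_pure_mult[of _ i _ j _ k _ i' _ j' _ k']
            A.scale_mult_left A.scale_mult_right)
          (simp add: tens3_simps V3.scale_left_commute mult_ac)
    qed (simp add: distrib_left V3.scale_right_distrib)
  qed (simp add: distrib_right V3.scale_right_distrib)
  then show "smult3 H c x * y = smult3 H c (x * y)" "x * smult3 H c y = smult3 H c (x * y)"
    by auto
qed

text \<open>Multiplicativity of an additive map need only be tested on products of homogeneous pure tensors,
  where both sides are explicit and only signs have to be compared.\<close>

lemma tensor2_hom:
  fixes f :: "'b \<Rightarrow> 'u::ring_1"
  assumes "\<And>x y. f (x + y) = f x + f y" "f 1 = 1"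
    and "\<And>a b a' b' i j k l. \<lbrakk>a \<in> grade H i; b \<in> grade H j; a' \<in> grade H k; b' \<in> grade H l\<rbrakk> \<Longrightarrow>
      f (tens2 H a b * tens2 H a' b') = f (tens2 H a b) * f (tens2 H a' b')"
  shows "unital_hom f"
proof -
  have "f (x * y) = f x * f y" for x y
  proof (induction x rule: tensor2_induct)
    case (pure a b i j)
    then show ?case
      by (induction y rule: tensor2_induct) (auto simp: assms distrib_left)
  qed (simp add: assms distrib_right)
  then show ?thesis using assms(2) by (simp add: unital_hom_def)
qed

lemma tensor3_hom:
  fixes f :: "'c \<Rightarrow> 'u::ring_1"
  assumes "\<And>x y. f (x + y) = f x + f y" "f 1 = 1"
    and "\<And>a b c a' b' c' i j k i' j' k'. \<lbrakk>a \<in> grade H i; b \<in> grade H j; c \<in> grade H k;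
        a' \<in> grade H i'; b' \<in> grade H j'; c' \<in> grade H k'\<rbrakk> \<Longrightarrow>
      f (tens3 H (tens2 H a b) c * tens3 H (tens2 H a' b') c') =
      f (tens3 H (tens2 H a b) c) * f (tens3 H (tens2 H a' b') c')"
  shows "unital_hom f"
proof -
  have "f (x * y) = f x * f y" for x y
  proof (induction x rule: tensor3_induct)
    case (pure a b c i j k)
    then show ?case
      by (induction y rule: tensor3_induct) (auto simp: assms distrib_left)
  qed (simp add: assms distrib_right)
  then show ?thesis using assms(2) by (simp add: unital_hom_def)
qed

lemma lift2:
  assumes "bilinear_map (smult1 H) (smult1 H) s \<beta>"
  shows "Vector_Spaces.linear (smult2 H) s (lift2 H s \<beta>)" "lift2 H s \<beta> (tens2 H a b) = \<beta> a b"
proof -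
  have "vector_space s"
    using assms by (simp add: bilinear_map_def Vector_Spaces.linear_iff)
  from theI'[OF tensor_product_lift[OF is_tensor_product2 assms this]]
  show "Vector_Spaces.linear (smult2 H) s (lift2 H s \<beta>)" "lift2 H s \<beta> (tens2 H a b) = \<beta> a b"
    unfolding lift2_def by auto
qed

lemma twist:
  "Vector_Spaces.linear (smult2 H) (smult2 H) (twist H)"
  "a \<in> grade H i \<Longrightarrow> b \<in> grade H j \<Longrightarrow>
     twist H (tens2 H a b) = smult2 H (koszul_sign i j) (tens2 H b a)"
proof -
  \<comment> \<open>The sign differs from 1 only if both arguments are odd.  Subtracting the flip of the odd parts
    twice therefore produces it, by a formula that is bilinear and valid in every characteristic.\<close>
  define \<beta> where
    "\<beta> a b = tens2 H b a - smult2 H 2 (tens2 H (A.odd_part b) (A.odd_part a))" for a b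
  have "bilinear_map (smult1 H) (smult1 H) (smult2 H) \<beta>"
    by (intro bilinear_mapI vector_spaces)
      (simp_all add: \<beta>_def tens2_simps A.odd_part_linear V2.scale_right_distrib
        V2.scale_right_diff_distrib V2.scale_left_commute)
  from lift2[OF this]
  have L: "Vector_Spaces.linear (smult2 H) (smult2 H) (lift2 H (smult2 H) \<beta>)"
    and \<beta>: "\<And>a b. lift2 H (smult2 H) \<beta> (tens2 H a b) = \<beta> a b" by auto
  have "smult2 H 2 x = x + x" for x
    using V2.scale_left_distrib[of 1 1 x] by simp
  then have "\<beta> a b = smult2 H (koszul_sign i j) (tens2 H b a)"
    if "a \<in> grade H i" "b \<in> grade H j" for a b i j
    using that bit_zero_or_one[of i] bit_zero_or_one[of j]
    by (auto simp: \<beta>_def koszul_sign_def A.odd_part_homogeneous tens2_simps)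
  with L \<beta> have ex: "Vector_Spaces.linear (smult2 H) (smult2 H) (lift2 H (smult2 H) \<beta>) \<and>
      (\<forall>i j. \<forall>a\<in>grade H i. \<forall>b\<in>grade H j.
        lift2 H (smult2 H) \<beta> (tens2 H a b) = smult2 H (koszul_sign i j) (tens2 H b a))"
    by simp
  have "\<exists>!L. Vector_Spaces.linear (smult2 H) (smult2 H) L \<and>
     (\<forall>i j. \<forall>a\<in>grade H i. \<forall>b\<in>grade H j.
        L (tens2 H a b) = smult2 H (koszul_sign i j) (tens2 H b a))"
  proof (rule ex_ex1I)
    fix L M
    assume L: "Vector_Spaces.linear (smult2 H) (smult2 H) L \<and>
     (\<forall>i j. \<forall>a\<in>grade H i. \<forall>b\<in>grade H j.
        L (tens2 H a b) = smult2 H (koszul_sign i j) (tens2 H b a))"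
      and M: "Vector_Spaces.linear (smult2 H) (smult2 H) M \<and>
     (\<forall>i j. \<forall>a\<in>grade H i. \<forall>b\<in>grade H j.
        M (tens2 H a b) = smult2 H (koszul_sign i j) (tens2 H b a))"
    have "L x = M x" for x
      using L M by (induction x rule: tensor2_induct) (auto simp: Vector_Spaces.linear_iff)
    then show "L = M" by blast
  qed (use ex in blast)
  from theI'[OF this]
  show "Vector_Spaces.linear (smult2 H) (smult2 H) (twist H)"
    "a \<in> grade H i \<Longrightarrow> b \<in> grade H j \<Longrightarrow>
     twist H (tens2 H a b) = smult2 H (koszul_sign i j) (tens2 H b a)"
    unfolding twist_def by auto
qed

lemma twist_linear:
  "twist H (x + y) = twist H x + twist H y"
  "twist H (smult2 H c x) = smult2 H c (twist H x)"
  using twist(1) by (auto simp: Vector_Spaces.linear_iff)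

lemma tens3':
  "Vector_Spaces.linear (smult2 H) (smult3 H) (tens3' H a)"
  "tens3' H a (tens2 H b c) = tens3 H (tens2 H a b) c"
proof -
  have "bilinear_map (smult1 H) (smult1 H) (smult3 H) (\<lambda>b c. tens3 H (tens2 H a b) c)"
    by (intro bilinear_mapI vector_spaces) (simp_all add: tens2_simps tens3_simps)
  from lift2[OF this]
  show "Vector_Spaces.linear (smult2 H) (smult3 H) (tens3' H a)"
    "tens3' H a (tens2 H b c) = tens3 H (tens2 H a b) c"
    by (simp_all add: tens3'_def)
qed

lemma bilinear_tens3': "bilinear_map (smult1 H) (smult2 H) (smult3 H) (tens3' H)"
proof (intro bilinear_mapI vector_spaces)
  have lin: "tens3' H a (x + y) = tens3' H a x + tens3' H a y"
    "tens3' H a (smult2 H c x) = smult3 H c (tens3' H a x)" for a c x y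
    using tens3'(1)[of a] by (auto simp: Vector_Spaces.linear_iff)
  then show "tens3' H a (x + y) = tens3' H a x + tens3' H a y"
    "tens3' H a (smult2 H c x) = smult3 H c (tens3' H a x)" for a c x y .
  show "tens3' H (a + a') x = tens3' H a x + tens3' H a' x" for a a' x
    by (induction x rule: tensor2_induct) (simp_all add: lin tens3' tens2_simps tens3_simps)
  show "tens3' H (smult1 H c a) x = smult3 H c (tens3' H a x)" for a c x
    by (induction x rule: tensor2_induct)
      (simp_all add: lin tens3' tens2_simps tens3_simps V3.scale_right_distrib)
qed

lemmas tens3'_simps = bilinear_mapD[OF bilinear_tens3']

lemma tens3'_one: "tens3' H 1 1 = 1"
  using tens3'(2)[of 1 1 1] by (simp add: tens_one)

lemma tens3'_mult_graded:
  assumes "x \<in> grade2 H j" "a' \<in> grade H k"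
  shows "tens3' H a x * tens3' H a' y = smult3 H (koszul_sign j k) (tens3' H (a * a') (x * y))"
proof (induction a rule: A.homogeneous_induct)
  case (homogeneous i a)
  from assms(1) show ?case
  proof (induction x rule: grade2_induct)
    case (pure b c p q)
    note x = pure
    have sign: "koszul_sign j k = koszul_sign p k * koszul_sign q k"
      using \<open>p + q = j\<close> koszul_sign_simps(3) by metis
    show ?case
    proof (induction y rule: tensor2_induct)
      case (pure b' c' r s)
      with x homogeneous assms(2) show ?case
        by (simp add: tens3' tens3_pure_mult[of a i b p c q a' k b' r c' s] tens2_mult[of b p c q b' r c' s]
            tens3'_simps sign mult_ac)
    qed (simp add: tens3'_simps distrib_left V3.scale_right_distrib)
  qed (simp add: tens3'_simps distrib_right V3.scale_right_distrib)
qed (simp add: tens3'_simps distrib_right V3.scale_right_distrib)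

lemma tens3'_mult_one: "tens3' H a x * tens3' H 1 y = tens3' H a (x * y)"
proof (induction x rule: tensor2_induct)
  case (pure b c i j)
  then show ?case
    using tens3'_mult_graded[OF tens2_grade A.one_grd, of b i c j a y] by (simp add: koszul_sign_simps)
qed (simp add: tens3'_simps distrib_right)

text \<open>The next three facts and \<open>tens3'_mult_one\<close> above are the sign-free cases: at least one of the
  two factors that are interchanged is even.\<close>

lemma tens3_one_mult: "tens3 H x 1 * tens3 H y c = tens3 H (x * y) c"
proof (induction y rule: tensor2_induct)
  case (pure a b i j)
  then show ?case
    using tens3_mult_graded[OF A.one_grd tens2_grade, of a i b j x c] by (simp add: koszul_sign_simps)
qed (simp add: tens3_simps distrib_left)

lemma tens3_mult_even:
  assumes "y \<in> grade2 H 0"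
  shows "tens3 H x c * tens3 H y 1 = tens3 H (x * y) c"
proof (induction c rule: A.homogeneous_induct)
  case (homogeneous i c)
  then show ?case using tens3_mult_graded[OF _ assms, of c i x 1] by (simp add: koszul_sign_simps)
qed (simp add: tens3_simps distrib_right)

lemma tens3'_even_mult:
  assumes "x \<in> grade2 H 0"
  shows "tens3' H 1 x * tens3' H a y = tens3' H a (x * y)"
proof (induction a rule: A.homogeneous_induct)
  case (homogeneous i a)
  then show ?case using tens3'_mult_graded[OF assms, of a i 1 y] by (simp add: koszul_sign_simps)
qed (simp add: tens3'_simps distrib_left)

subsection \<open>The maps between the tensor powers\<close>

lemma map_left:
  assumes "Vector_Spaces.linear (smult1 H) (smult2 H) f"
  shows "map_left H f (tens2 H a b) = tens3 H (f a) b"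
    "map_left H f (x + y) = map_left H f x + map_left H f y"
    "map_left H f (smult2 H c x) = smult3 H c (map_left H f x)"
proof -
  have "bilinear_map (smult1 H) (smult1 H) (smult3 H) (\<lambda>a b. tens3 H (f a) b)"
    using assms
    by (intro bilinear_mapI vector_spaces) (simp_all add: tens3_simps Vector_Spaces.linear_iff)
  from lift2[OF this]
  show "map_left H f (tens2 H a b) = tens3 H (f a) b"
    "map_left H f (x + y) = map_left H f x + map_left H f y"
    "map_left H f (smult2 H c x) = smult3 H c (map_left H f x)"
    by (simp_all add: map_left_def Vector_Spaces.linear_iff)
qed

lemma map_right:
  assumes "Vector_Spaces.linear (smult1 H) (smult2 H) f"
  shows "map_right H f (tens2 H a b) = tens3' H a (f b)"
    "map_right H f (x + y) = map_right H f x + map_right H f y"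
    "map_right H f (smult2 H c x) = smult3 H c (map_right H f x)"
proof -
  have "bilinear_map (smult1 H) (smult1 H) (smult3 H) (\<lambda>a b. tens3' H a (f b))"
    using assms
    by (intro bilinear_mapI vector_spaces) (simp_all add: tens3'_simps Vector_Spaces.linear_iff)
  from lift2[OF this]
  show "map_right H f (tens2 H a b) = tens3' H a (f b)"
    "map_right H f (x + y) = map_right H f x + map_right H f y"
    "map_right H f (smult2 H c x) = smult3 H c (map_right H f x)"
    by (simp_all add: map_right_def Vector_Spaces.linear_iff)
qed

lemmas comult_left = map_left[OF comult_linear]
lemmas comult_right = map_right[OF comult_linear]

lemma twist_left:
  "Vector_Spaces.linear (smult3 H) (smult3 H) (twist_left H)"
  "twist_left H (tens3 H x c) = tens3 H (twist H x) c"
proof -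
  have "bilinear_map (smult2 H) (smult1 H) (smult3 H) (\<lambda>x c. tens3 H (twist H x) c)"
    by (intro bilinear_mapI vector_spaces) (simp_all add: tens3_simps twist_linear)
  from theI'[OF tensor_product_lift[OF is_tensor_product3 this vector_spaces(3)]]
  show "Vector_Spaces.linear (smult3 H) (smult3 H) (twist_left H)"
    "twist_left H (tens3 H x c) = tens3 H (twist H x) c"
    unfolding twist_left_def by auto
qed

lemma twist_left_linear:
  "twist_left H (x + y) = twist_left H x + twist_left H y"
  "twist_left H (smult3 H c x) = smult3 H c (twist_left H x)"
  using twist_left(1) by (auto simp: Vector_Spaces.linear_iff)

lemma twist_left_pure:
  assumes "a \<in> grade H i" "b \<in> grade H j"
  shows "twist_left H (tens3 H (tens2 H a b) c) =
    smult3 H (koszul_sign i j) (tens3 H (tens2 H b a) c)"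
  by (simp add: twist_left(2) twist(2)[OF assms] tens3_simps)

text \<open>The description of \<open>twist_right\<close> uses the bracketing $A\otimes(A\otimes A)$, whereas the universal
  property is available for $(A\otimes A)\otimes A$.  For existence $a\otimes b\otimes c$ is therefore
  lifted in two stages: first in $a\otimes b$ with $c$ fixed, then in $c$.\<close>

lemma twist_right:
  "Vector_Spaces.linear (smult3 H) (smult3 H) (twist_right H)"
  "twist_right H (tens3' H a x) = tens3' H a (twist H x)"
proof -
  define \<beta> where "\<beta> x c = lift2 H (smult3 H) (\<lambda>a b. tens3' H a (twist H (tens2 H b c))) x" for x c
  have "bilinear_map (smult1 H) (smult1 H) (smult3 H) (\<lambda>a b. tens3' H a (twist H (tens2 H b c)))" for c
    by (intro bilinear_mapI vector_spaces) (simp_all add: tens3'_simps tens2_simps twist_linear)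
  note lift = lift2[OF this, folded \<beta>_def]
  have lin: "\<beta> (x + y) c = \<beta> x c + \<beta> y c" "\<beta> (smult2 H d x) c = smult3 H d (\<beta> x c)" for x y c d
    using lift(1)[of c] by (auto simp: Vector_Spaces.linear_iff \<beta>_def)
  have "bilinear_map (smult2 H) (smult1 H) (smult3 H) \<beta>"
  proof (intro bilinear_mapI vector_spaces lin)
    show "\<beta> x (c + c') = \<beta> x c + \<beta> x c'" for x c c'
      by (induction x rule: tensor2_induct)
        (simp_all add: lin lift tens3'_simps tens2_simps twist_linear)
    show "\<beta> x (smult1 H d c) = smult3 H d (\<beta> x c)" for x c d
      by (induction x rule: tensor2_induct)
        (simp_all add: lin lift tens3'_simps tens2_simps twist_linear V3.scale_right_distrib)
  qed
  from tensor_product_lift[OF is_tensor_product3 this vector_spaces(3)]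
  obtain L where L: "Vector_Spaces.linear (smult3 H) (smult3 H) L" "\<And>x c. L (tens3 H x c) = \<beta> x c"
    by blast
  have "L (tens3' H a x) = tens3' H a (twist H x)" for a x
    using L by (induction x rule: tensor2_induct)
      (simp_all add: tens3' tens3'_simps lift Vector_Spaces.linear_iff twist_linear)
  with L have ex: "Vector_Spaces.linear (smult3 H) (smult3 H) L \<and>
      (\<forall>a x. L (tens3' H a x) = tens3' H a (twist H x))" by blast
  have "\<exists>!L. Vector_Spaces.linear (smult3 H) (smult3 H) L \<and>
      (\<forall>a x. L (tens3' H a x) = tens3' H a (twist H x))"
  proof (rule ex_ex1I)
    fix L M
    assume L: "Vector_Spaces.linear (smult3 H) (smult3 H) L \<and>
        (\<forall>a x. L (tens3' H a x) = tens3' H a (twist H x))"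
      and M: "Vector_Spaces.linear (smult3 H) (smult3 H) M \<and>
        (\<forall>a x. M (tens3' H a x) = tens3' H a (twist H x))"
    have "L x = M x" for x
      using L M by (induction x rule: tensor3_induct)
        (auto simp: Vector_Spaces.linear_iff tens3'(2)[symmetric])
    then show "L = M" by blast
  qed (use ex in blast)
  from theI'[OF this]
  show "Vector_Spaces.linear (smult3 H) (smult3 H) (twist_right H)"
    "twist_right H (tens3' H a x) = tens3' H a (twist H x)"
    unfolding twist_right_def by auto
qed

lemma twist_right_linear:
  "twist_right H (x + y) = twist_right H x + twist_right H y"
  "twist_right H (smult3 H c x) = smult3 H c (twist_right H x)"
  using twist_right(1) by (auto simp: Vector_Spaces.linear_iff)

lemma twist_right_pure:
  assumes "b \<in> grade H j" "c \<in> grade H k"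
  shows "twist_right H (tens3 H (tens2 H a b) c) =
    smult3 H (koszul_sign j k) (tens3 H (tens2 H a c) b)"
  by (simp add: tens3'(2)[symmetric] twist_right(2) twist(2)[OF assms] tens3'_simps)

subsection \<open>Multiplicativity\<close>

lemma twist_hom: "unital_hom (twist H)"
proof (rule tensor2_hom)
  show "twist H 1 = 1"
    using twist(2)[OF A.one_grd A.one_grd] by (simp add: tens_one koszul_sign_simps)
next
  fix a b a' b' i j k l
  assume g: "a \<in> grade H i" "b \<in> grade H j" "a' \<in> grade H k" "b' \<in> grade H l"
  show "twist H (tens2 H a b * tens2 H a' b') = twist H (tens2 H a b) * twist H (tens2 H a' b')"
    using twist(2)[OF A.mult_grd[OF g(1,3)] A.mult_grd[OF g(2,4)], unfolded koszul_sign_simps]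
    by (simp add: tens2_mult[OF g] tens2_mult[OF g(2,1,4,3)] twist_linear twist(2)[OF g(1,2)]
        twist(2)[OF g(3,4)] smult2_mult mult_ac koszul_sign_square koszul_sign_commute[of k j])
qed (rule twist_linear)

lemma twist_left_hom: "unital_hom (twist_left H)"
proof (rule tensor3_hom)
  show "twist_left H 1 = 1"
    using twist_left_pure[OF A.one_grd A.one_grd, of 1] by (simp add: tens_one koszul_sign_simps)
next
  fix a b c a' b' c' i j k i' j' k'
  assume g: "a \<in> grade H i" "b \<in> grade H j" "c \<in> grade H k"
    and g': "a' \<in> grade H i'" "b' \<in> grade H j'" "c' \<in> grade H k'"
  show "twist_left H (tens3 H (tens2 H a b) c * tens3 H (tens2 H a' b') c') =
      twist_left H (tens3 H (tens2 H a b) c) * twist_left H (tens3 H (tens2 H a' b') c')"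
    using twist_left_pure[OF A.mult_grd[OF g(1) g'(1)] A.mult_grd[OF g(2) g'(2)], of "c * c'",
        unfolded koszul_sign_simps]
    by (simp add: tens3_pure_mult[OF g g'] tens3_pure_mult[OF g(2,1,3) g'(2,1,3)] twist_left_linear
        twist_left_pure[OF g(1,2)] twist_left_pure[OF g'(1,2)] smult3_mult mult_ac
        koszul_sign_square koszul_sign_commute[of i' j])
qed (rule twist_left_linear)

lemma twist_right_hom: "unital_hom (twist_right H)"
proof (rule tensor3_hom)
  show "twist_right H 1 = 1"
    using twist_right_pure[OF A.one_grd A.one_grd, of 1] by (simp add: tens_one koszul_sign_simps)
next
  fix a b c a' b' c' i j k i' j' k'
  assume g: "a \<in> grade H i" "b \<in> grade H j" "c \<in> grade H k"
    and g': "a' \<in> grade H i'" "b' \<in> grade H j'" "c' \<in> grade H k'"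
  show "twist_right H (tens3 H (tens2 H a b) c * tens3 H (tens2 H a' b') c') =
      twist_right H (tens3 H (tens2 H a b) c) * twist_right H (tens3 H (tens2 H a' b') c')"
    using twist_right_pure[OF A.mult_grd[OF g(2) g'(2)] A.mult_grd[OF g(3) g'(3)], of "a * a'",
        unfolded koszul_sign_simps]
    by (simp add: tens3_pure_mult[OF g g'] tens3_pure_mult[OF g(1,3,2) g'(1,3,2)] twist_right_linear
        twist_right_pure[OF g(2,3)] twist_right_pure[OF g'(2,3)] smult3_mult mult_ac
        koszul_sign_square koszul_sign_commute[of j' k])
qed (rule twist_right_linear)

lemma X12_hom: "unital_hom (X12 H)"
  by (simp add: unital_hom_def X12_def tens_one tens3_one_mult)

lemma X23_hom: "unital_hom (X23 H)"
  by (simp add: unital_hom_def X23_def tens3'_one tens3'_mult_one)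

lemma comult_left_hom: "unital_hom (map_left H (comult H))"
proof (rule tensor2_hom)
  show "map_left H (comult H) 1 = 1"
    using comult_left(1)[of 1 1] by (simp add: tens_one comult_one)
next
  fix a b a' b' i j k l
  assume g: "a \<in> grade H i" "b \<in> grade H j" "a' \<in> grade H k" "b' \<in> grade H l"
  show "map_left H (comult H) (tens2 H a b * tens2 H a' b') =
      map_left H (comult H) (tens2 H a b) * map_left H (comult H) (tens2 H a' b')"
    by (simp add: tens2_mult[OF g] comult_left tens3_mult_graded[OF g(2) comult_grade[OF g(3)]]
        comult_mult)
qed (rule comult_left)

lemma comult_right_hom: "unital_hom (map_right H (comult H))"
proof (rule tensor2_hom)
  show "map_right H (comult H) 1 = 1"
    using comult_right(1)[of 1 1] by (simp add: tens_one tens3'_one comult_one)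
next
  fix a b a' b' i j k l
  assume g: "a \<in> grade H i" "b \<in> grade H j" "a' \<in> grade H k" "b' \<in> grade H l"
  show "map_right H (comult H) (tens2 H a b * tens2 H a' b') =
      map_right H (comult H) (tens2 H a b) * map_right H (comult H) (tens2 H a' b')"
    by (simp add: tens2_mult[OF g] comult_right tens3'_mult_graded[OF comult_grade[OF g(2)] g(3)]
        comult_mult)
qed (rule comult_right)

subsection \<open>Permutations of the legs\<close>

lemma twist_left_involution: "twist_left H (twist_left H x) = x"
proof (induction x rule: tensor3_induct)
  case (pure a b c i j k)
  then show ?case
    by (simp add: twist_left_pure[of _ i _ j] twist_left_pure[of _ j _ i] twist_left_linear
        koszul_sign_commute[of j i] koszul_sign_square)
qed (simp add: twist_left_linear)

lemma twist_right_involution: "twist_right H (twist_right H x) = x"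
proof (induction x rule: tensor3_induct)
  case (pure a b c i j k)
  then show ?case
    by (simp add: twist_right_pure[of _ j _ k] twist_right_pure[of _ k _ j] twist_right_linear
        koszul_sign_commute[of k j] koszul_sign_square)
qed (simp add: twist_right_linear)

lemma twist_braid:
  "twist_left H (twist_right H (twist_left H x)) = twist_right H (twist_left H (twist_right H x))"
proof (induction x rule: tensor3_induct)
  case (pure a b c i j k)
  then show ?case
    by (simp add: twist_right_pure[of _ i _ j] twist_right_pure[of _ j _ k] twist_right_pure[of _ i _ k]
        twist_left_pure[of _ i _ j] twist_left_pure[of _ j _ k] twist_left_pure[of _ i _ k]
        twist_left_linear twist_right_linear mult_ac)
qed (simp add: twist_left_linear twist_right_linear)

lemma twist_left_X12: "twist_left H (X12 H x) = X12 H (twist H x)"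
  by (simp add: X12_def twist_left)

lemma twist_right_X23: "twist_right H (X23 H x) = X23 H (twist H x)"
  by (simp add: X23_def twist_right)

lemma twist_right_X12: "twist_right H (X12 H x) = X13 H x"
  by (simp add: X13_def)

lemma twist_left_X23: "twist_left H (X23 H x) = X13 H x"
  unfolding X13_def X12_def X23_def
proof (induction x rule: tensor2_induct)
  case (pure a b i j)
  then show ?case
    by (simp add: tens3' twist_left_pure[OF A.one_grd] twist_right_pure[OF _ A.one_grd] koszul_sign_simps)
qed (simp add: tens3_simps tens3'_simps twist_left_linear twist_right_linear)

lemma twist_left_X13: "twist_left H (X13 H x) = X23 H x"
  by (metis twist_left_X23 twist_left_involution)

lemma twist_right_X13: "twist_right H (X13 H x) = X12 H x"
  by (simp add: X13_def twist_right_involution)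

text \<open>Moving \<open>a\<close> past a homogeneous \<open>y\<close> costs a single sign, because \<open>twist_right \<circ> twist_left\<close>
  carries \<open>a\<close> past the two factors of \<open>y\<close> one after the other.\<close>

lemma cycle_tens3':
  assumes "a \<in> grade H i" "y \<in> grade2 H d"
  shows "twist_right H (twist_left H (tens3' H a y)) = smult3 H (koszul_sign i d) (tens3 H y a)"
  using assms(2)
proof (induction y rule: grade2_induct)
  case (pure b c j k)
  have sign: "koszul_sign i d = koszul_sign i j * koszul_sign i k"
    using pure(3) koszul_sign_simps(4) by metis
  from pure(1,2) assms(1) show ?case
    by (simp add: sign tens3' twist_left_pure[of _ i _ j] twist_right_pure[of _ i _ k] twist_left_linear
        twist_right_linear mult_ac)
qed (simp add: tens3_simps tens3'_simps twist_left_linear twist_right_linear V3.scale_right_distrib)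

text \<open>As the coproduct preserves degrees, \<open>a\<close> passes $\Delta(b)$ with the same sign as it passes \<open>b\<close>.\<close>

lemma cycle_comult_right:
  "twist_right H (twist_left H (map_right H (comult H) x)) = map_left H (comult H) (twist H x)"
proof (induction x rule: tensor2_induct)
  case (pure a b i j)
  then show ?case
    by (simp add: comult_right comult_left cycle_tens3'[OF pure(1) comult_grade[OF pure(2)]] twist(2))
qed (simp add: comult_right comult_left twist_left_linear twist_right_linear twist_linear)

lemma cycle_comult_left:
  "twist_left H (twist_right H (map_left H (comult H) x)) = map_right H (comult H) (twist H x)"
proof -
  have "twist H (twist H x) = x"
  proof (induction x rule: tensor2_induct)
    case (pure a b i j)
    then show ?case
      by (simp add: twist(2)[of _ i _ j] twist(2)[of _ j _ i] twist_linear
          koszul_sign_commute[of j i] koszul_sign_square)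
  qed (simp add: twist_linear)
  then show ?thesis
    by (metis cycle_comult_right twist_left_involution twist_right_involution)
qed

subsection \<open>Evenness of R and of twistors\<close>

lemma counit_left_pure: "counit_left H (tens2 H a b) = smult1 H (counit H a) b"
  and counit_left_add: "counit_left H (x + y) = counit_left H x + counit_left H y"
  and counit_left_scale: "counit_left H (smult2 H c x) = smult1 H c (counit_left H x)"
proof -
  have "bilinear_map (smult1 H) (smult1 H) (smult1 H) (\<lambda>a b. smult1 H (counit H a) b)"
    using counit_linear
    by (intro bilinear_mapI vector_spaces)
      (auto simp: Vector_Spaces.linear_iff A.scale_left_distrib A.scale_right_distrib mult_ac)
  from lift2[OF this]
  show "counit_left H (tens2 H a b) = smult1 H (counit H a) b"
    "counit_left H (x + y) = counit_left H x + counit_left H y"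
    "counit_left H (smult2 H c x) = smult1 H c (counit_left H x)"
    by (simp_all add: counit_left_def Vector_Spaces.linear_iff)
qed

lemma counit_left_odd: "x \<in> grade2 H 1 \<Longrightarrow> counit_left H x \<in> grade H 1"
proof (induction x rule: grade2_induct)
  case (pure a b i j)
  show ?case
  proof (cases "i = 1")
    case True
    then show ?thesis
      using pure by (simp add: counit_left_pure counit_grade grade_zero)
  next
    case False
    then have "j = 1" using pure(3) bit_zero_or_one[of i] by auto
    then show ?thesis using pure by (simp add: counit_left_pure grade_scale)
  qed
qed (simp add: counit_left_add A.subspace_add[OF A.subspace_grd])

text \<open>The counit vanishes on odd elements, so \<open>counit_left\<close> preserves degrees, and 1 is not odd.\<close>

lemma even_if_counit_left_one:
  assumes "x \<in> grade2 H d" "counit_left H x = 1"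
  shows "x \<in> grade2 H 0"
proof (rule ccontr)
  assume "\<not> ?thesis"
  then have "x \<in> grade2 H 1" using assms(1) bit_zero_or_one[of d] by auto
  then have "1 \<in> grade H 0 \<inter> grade H 1"
    using counit_left_odd assms(2) A.one_grd by (metis IntI)
  then show False by (simp add: A.grd_disjoint)
qed

text \<open>Apply the algebra homomorphism $\epsilon\otimes1\otimes1$ to
  $(\Delta\otimes1)\mathcal R=\mathcal R_{13}\mathcal R_{23}$: the result is
  $\mathcal R=(1\otimes u)\mathcal R$ with $u=(\epsilon\otimes1)\mathcal R$.  Cancelling
  $\mathcal R$ gives $1\otimes u=1$, hence $u=1$.  This is needed to see that $\mathcal R$ is even.\<close>

lemma counit_left_R: "counit_left H (Rmat H) = 1"
proof -
  have "bilinear_map (smult2 H) (smult1 H) (smult2 H) (\<lambda>x c. tens2 H (counit_left H x) c)"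
    by (intro bilinear_mapI vector_spaces)
      (simp_all add: tens2_simps counit_left_add counit_left_scale)
  from tensor_product_lift[OF is_tensor_product3 this vector_spaces(2)]
  obtain E where lin: "Vector_Spaces.linear (smult3 H) (smult2 H) E"
    and E: "\<And>x c. E (tens3 H x c) = tens2 H (counit_left H x) c" by blast
  have add: "E (x + y) = E x + E y" and scale: "E (smult3 H k x) = smult2 H k (E x)" for x y k
    using lin by (auto simp: Vector_Spaces.linear_iff)
  have counit_left_one: "counit_left H 1 = 1"
    using counit_left_pure[of 1 1] by (simp add: tens_one counit_one)
  have "unital_hom E"
  proof (rule tensor3_hom)
    show "E 1 = 1"
      using E[of 1 1] by (simp add: tens_one counit_left_one)
  next
    fix a b c a' b' c' i j k i' j' k'
    assume g: "a \<in> grade H i" "b \<in> grade H j" "c \<in> grade H k"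
      and g': "a' \<in> grade H i'" "b' \<in> grade H j'" "c' \<in> grade H k'"
    show "E (tens3 H (tens2 H a b) c * tens3 H (tens2 H a' b') c') =
        E (tens3 H (tens2 H a b) c) * E (tens3 H (tens2 H a' b') c')"
      using g'(1) counit_grade[of a'] bit_zero_or_one[of i']
      by (auto simp: tens3_pure_mult[OF g g'] E scale counit_left_pure counit_mult koszul_sign_simps
          tens2_simps smult2_mult tens2_mult[OF g(2,3) g'(2,3)] mult_ac)
  qed (rule add)
  then have E_mult: "E (x * y) = E x * E y" for x y by (simp add: unital_hom_def)
  have E_comult: "E (map_left H (comult H) x) = x" for x
    by (induction x rule: tensor2_induct) (simp_all add: comult_left E counit_left add)
  have E_X23: "E (X23 H x) = x" for x
    unfolding X23_def
    by (induction x rule: tensor2_induct)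
      (simp_all add: tens3' tens3'_simps E counit_left_pure counit_one add)
  have E_X13: "E (X13 H x) = tens2 H 1 (counit_left H x)" for x
    unfolding X13_def X12_def
  proof (induction x rule: tensor2_induct)
    case (pure a b i j)
    show ?case
      by (simp add: twist_right_pure[OF pure(2) A.one_grd] koszul_sign_simps E counit_left_pure tens2_simps)
  qed (simp add: tens3_simps twist_right_linear add counit_left_add tens2_simps)
  obtain S where S: "Rmat H * S = 1" using R_invertible by (auto simp: is_invertible_def)
  have "Rmat H = tens2 H 1 (counit_left H (Rmat H)) * Rmat H"
    by (metis E_comult E_mult E_X13 E_X23 R_left)
  then have "tens2 H 1 (counit_left H (Rmat H)) = 1"
    by (metis S mult.assoc mult.right_neutral)
  then have "counit_left H (tens2 H 1 (counit_left H (Rmat H))) = counit_left H (tens2 H 1 1)"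
    by (simp add: tens_one)
  then show ?thesis by (simp add: counit_left_pure counit_one)
qed

lemma R_even: "Rmat H \<in> grade2 H 0"
  using R_homogeneous counit_left_R even_if_counit_left_one by blast

lemma twistor_even: "twistor H F \<Longrightarrow> F \<in> grade2 H 0"
  using even_if_counit_left_one by (auto simp: twistor_def)

subsection \<open>Intertwining relations in the third tensor power\<close>

text \<open>Evenness of $\mathcal R$ enters here: $\mathcal R_{12}$ has to be moved past the third tensor factor
  without a sign.\<close>

lemma R12_intertwines:
  "X12 H (Rmat H) * map_left H (comult H) x = twist_left H (map_left H (comult H) x) * X12 H (Rmat H)"
proof (induction x rule: tensor2_induct)
  case (pure a b i j)
  show ?case
    by (simp add: comult_left X12_def tens3_one_mult twist_left tens3_mult_even[OF R_even] R_intertwines)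
qed (simp add: comult_left twist_left_linear distrib_left distrib_right)

lemma R23_intertwines:
  "X23 H (Rmat H) * map_right H (comult H) x = twist_right H (map_right H (comult H) x) * X23 H (Rmat H)"
proof (induction x rule: tensor2_induct)
  case (pure a b i j)
  show ?case
    by (simp add: comult_right X23_def tens3'_mult_one twist_right tens3'_even_mult[OF R_even] R_intertwines)
qed (simp add: comult_right twist_right_linear distrib_left distrib_right)

end

section \<open>Twisting by a shifted cocycle\<close>

text \<open>Here \<open>G\<close> stands for $F_{23}(\lambda+h^{(1)})$ at a fixed parameter.  It is invertible because the
  other three factors of the cocycle identity are.\<close>

locale shifted_twist = qt_hopf_superalgebra H
  for H :: "('k::field, 'a::ring_1, 'b::ring_1, 'c::ring_1) hopf_data" +
  fixes F :: 'b and G :: 'c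
  assumes twistor: "twistor H F"
    and cocycle: "X12 H F * map_left H (comult H) F = G * map_right H (comult H) F"
begin

abbreviation \<Delta>1 :: "'b \<Rightarrow> 'c" where "\<Delta>1 \<equiv> map_left H (comult H)"
abbreviation \<Delta>2 :: "'b \<Rightarrow> 'c" where "\<Delta>2 \<equiv> map_right H (comult H)"
abbreviation \<tau>1 :: "'c \<Rightarrow> 'c" where "\<tau>1 \<equiv> twist_left H"
abbreviation \<tau>2 :: "'c \<Rightarrow> 'c" where "\<tau>2 \<equiv> twist_right H"
abbreviation R\<^sub>F :: 'b where "R\<^sub>F \<equiv> twisted_R H F"

lemma X13_hom: "unital_hom (X13 H)"
  using twist_right_hom X12_hom by (simp add: unital_hom_def X13_def)

lemmas homs = twist_hom twist_left_hom twist_right_hom X12_hom X13_hom X23_hom comult_left_hom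
  comult_right_hom
lemmas hom_mult = homs[THEN unital_hom_mult]
lemmas hom_inverse = homs[THEN unital_hom_inverse]
lemmas hom_invertible = homs[THEN is_invertible_hom]
lemmas hom_inv_of = homs[THEN inv_of_hom]

lemma F_invertible: "is_invertible F"
  using twistor by (simp add: twistor_def)

lemma F_images_invertible:
  "is_invertible (X12 H F)" "is_invertible (X23 H F)" "is_invertible (\<Delta>1 F)" "is_invertible (\<Delta>2 F)"
  by (simp_all add: hom_invertible F_invertible)

lemma G_eq: "G = X12 H F * \<Delta>1 F * \<Delta>2 (inv_of F)"
  by (simp add: cocycle mult.assoc unital_hom_inverse[OF comult_right_hom] inv_of F_invertible)

lemma G_invertible: "is_invertible G"
  unfolding G_eq by (intro is_invertible_mult hom_invertible is_invertible_inv_of F_invertible)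

lemma inverse_cocycle: "\<Delta>1 (inv_of F) * X12 H (inv_of F) = \<Delta>2 (inv_of F) * inv_of G"
proof -
  have "inv_of (X12 H F * \<Delta>1 F) = inv_of (G * \<Delta>2 F)" by (simp only: cocycle)
  then show ?thesis
    by (simp add: inv_of_mult F_images_invertible G_invertible hom_inv_of F_invertible)
qed

lemma \<Delta>2_inv: "\<Delta>2 (inv_of F) = \<Delta>1 (inv_of F) * X12 H (inv_of F) * G"
  by (simp add: inverse_cocycle mult.assoc inv_of G_invertible)

lemma \<Delta>1_inv: "\<Delta>1 (inv_of F) = \<Delta>2 (inv_of F) * inv_of G * X12 H F"
  by (simp add: inverse_cocycle[symmetric] mult.assoc unital_hom_inverse[OF X12_hom] inv_of F_invertible)

lemma coassociator_eq: "twisted_coassociator H F = G * inv_of (X23 H F)"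
  by (simp add: twisted_coassociator_def G_eq)

lemma twisted_comult_linear: "Vector_Spaces.linear (smult1 H) (smult2 H) (twisted_comult H F)"
  using comult_linear
  by (simp add: Vector_Spaces.linear_iff twisted_comult_def distrib_left distrib_right smult2_mult)

text \<open>Conjugation by $F$ in the first two legs can be pulled out of $\Delta_\lambda\otimes1$ because $F$ is
  even.  The identity is first proved after multiplication by $F_{12}$ on the right, which avoids
  having to show that the inverse of $F$ is even, too.\<close>

lemma map_left_twisted_comult:
  "map_left H (twisted_comult H F) x = X12 H F * \<Delta>1 x * X12 H (inv_of F)"
proof -
  have "map_left H (twisted_comult H F) x * X12 H F = X12 H F * \<Delta>1 x"
  proof (induction x rule: tensor2_induct)
    case (pure a b i j)
    show ?case
      by (simp add: map_left[OF twisted_comult_linear] comult_left X12_def tens3_one_mult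
          tens3_mult_even[OF twistor_even[OF twistor]])
        (simp add: twisted_comult_def mult.assoc inv_of F_invertible)
  qed (simp add: map_left[OF twisted_comult_linear] comult_left distrib_left distrib_right)
  then show ?thesis
    by (metis F_invertible X12_hom inv_of(1) mult.assoc mult.right_neutral unital_hom_inverse)
qed

lemma map_right_twisted_comult:
  "map_right H (twisted_comult H F) x = X23 H F * \<Delta>2 x * X23 H (inv_of F)"
proof -
  have "map_right H (twisted_comult H F) x * X23 H F = X23 H F * \<Delta>2 x"
  proof (induction x rule: tensor2_induct)
    case (pure a b i j)
    show ?case
      by (simp add: map_right[OF twisted_comult_linear] comult_right X23_def tens3'_mult_one
          tens3'_even_mult[OF twistor_even[OF twistor]])
        (simp add: twisted_comult_def mult.assoc inv_of F_invertible)
  qed (simp add: map_right[OF twisted_comult_linear] comult_right distrib_left distrib_right)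
  then show ?thesis
    by (metis F_invertible X23_hom inv_of(1) mult.assoc mult.right_neutral unital_hom_inverse)
qed

lemma twisted_R_intertwines:
  "twist H (twisted_comult H F a) * R\<^sub>F = R\<^sub>F * twisted_comult H F a"
proof -
  have "twist H (twisted_comult H F a) * R\<^sub>F =
      twist H F * twist H (comult H a) * (twist H (inv_of F) * twist H F) * Rmat H * inv_of F"
    by (simp add: twisted_comult_def twisted_R_def hom_mult mult.assoc)
  also have "\<dots> = twist H F * (twist H (comult H a) * Rmat H) * inv_of F"
    by (simp add: unital_hom_inverse[OF twist_hom] inv_of F_invertible mult.assoc)
  also have "\<dots> = twist H F * Rmat H * comult H a * inv_of F"
    by (simp add: R_intertwines mult.assoc)
  also have "\<dots> = twist H F * Rmat H * (inv_of F * F) * comult H a * inv_of F"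
    by (simp add: inv_of F_invertible)
  also have "\<dots> = R\<^sub>F * twisted_comult H F a"
    by (simp add: twisted_comult_def twisted_R_def mult.assoc)
  finally show ?thesis .
qed

lemma shifted_R12_eq: "shifted_R12 H G = \<tau>2 (\<tau>1 (\<tau>2 G)) * X12 H (Rmat H) * \<tau>2 (\<tau>1 (inv_of G))"
  by (simp add: shifted_R12_def shifted_F_def perm3_def hom_inv_of hom_invertible G_invertible)

lemma shifted_R13_eq: "shifted_R13 H G = \<tau>1 (\<tau>2 G) * X13 H (Rmat H) * \<tau>1 (inv_of G)"
  by (simp add: shifted_R13_def shifted_F_def perm3_def hom_inv_of hom_invertible G_invertible)

lemma shifted_R23_eq: "shifted_R23 H G = \<tau>2 G * X23 H (Rmat H) * inv_of G"
  by (simp add: shifted_R23_def shifted_F_def perm3_def)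

lemmas leg_simps = twist_left_X12 twist_right_X12 twist_left_X23 twist_right_X23 twist_left_X13
  twist_right_X13

lemma inv_cyc_coassociator:
  "inv_of (cyc231 H (twisted_coassociator H F)) = X12 H F * \<tau>2 (\<tau>1 (inv_of G))"
proof -
  have "inv_of (cyc231 H (twisted_coassociator H F)) = \<tau>2 (\<tau>1 (inv_of (G * X23 H (inv_of F))))"
    by (simp add: cyc231_def coassociator_eq hom_inv_of hom_invertible is_invertible_mult
        G_invertible F_invertible is_invertible_inv_of)
  also have "inv_of (G * X23 H (inv_of F)) = X23 H F * inv_of G"
    by (simp add: inv_of_mult hom_inv_of hom_invertible
        G_invertible F_invertible is_invertible_inv_of inv_of_inv_of)
  finally show ?thesis by (simp add: hom_mult leg_simps)
qed

text \<open>The relation for $\mathcal R_{12}$ transported by the exchange of the second and third legs.\<close>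

lemma R13_\<tau>2_\<Delta>1: "X13 H (Rmat H) * \<tau>2 (\<Delta>1 x) = \<tau>2 (\<tau>1 (\<Delta>1 x)) * X13 H (Rmat H)"
  using arg_cong[OF R12_intertwines, of \<tau>2] by (simp add: hom_mult leg_simps)

text \<open>The relation for $\mathcal R_{23}$ transported by the exchange of the first two legs.\<close>

lemma R13_\<tau>1_\<Delta>2: "X13 H (Rmat H) * \<tau>1 (\<Delta>2 x) = \<tau>1 (\<tau>2 (\<Delta>2 x)) * X13 H (Rmat H)"
  using arg_cong[OF R23_intertwines, of \<tau>1] by (simp add: hom_mult leg_simps)

text \<open>In $F_{12}\cdot(\Delta\otimes1)F^T\cdot\mathcal R_{13}\mathcal R_{23}\cdot(\Delta\otimes1)F^{-1}\cdot
  F_{12}^{-1}$ the cocycle identity is used three times: as it stands, to make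
  $(1\otimes\Delta)F^{-1}$ appear, which passes $\mathcal R_{23}$; with the last two legs exchanged,
  to return to $(\Delta\otimes1)F^{-1}$, which passes $\mathcal R_{13}$; and cyclically permuted, to
  cancel what remains against $(\Delta\otimes1)F^T$.\<close>

lemma left_coproduct_twisted_R:
  "map_left H (twisted_comult H F) R\<^sub>F =
     inv_of (cyc231 H (twisted_coassociator H F)) * X13 H R\<^sub>F * shifted_R23 H G"
proof -
  let ?F' = "inv_of F" and ?R13 = "X13 H (Rmat H)" and ?R23 = "X23 H (Rmat H)"
  have "map_left H (twisted_comult H F) R\<^sub>F =
      X12 H F * \<Delta>1 (twist H F) * ?R13 * ?R23 * (\<Delta>1 ?F' * X12 H ?F')"
    by (simp add: map_left_twisted_comult twisted_R_def hom_mult R_left mult.assoc)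
  also have "\<dots> = X12 H F * \<Delta>1 (twist H F) * ?R13 * (?R23 * \<Delta>2 ?F') * inv_of G"
    by (simp only: inverse_cocycle mult.assoc)
  also have "?R23 * \<Delta>2 ?F' = \<tau>2 (\<Delta>1 ?F') * X13 H ?F' * \<tau>2 G * ?R23"
    by (simp add: R23_intertwines) (simp add: \<Delta>2_inv hom_mult leg_simps)
  also have "X12 H F * \<Delta>1 (twist H F) * ?R13 *
        (\<tau>2 (\<Delta>1 ?F') * X13 H ?F' * \<tau>2 G * ?R23) * inv_of G =
      X12 H F * \<Delta>1 (twist H F) * (?R13 * \<tau>2 (\<Delta>1 ?F')) * X13 H ?F' * \<tau>2 G * ?R23 * inv_of G"
    by (simp only: mult.assoc)
  also have "\<dots> = X12 H F * (\<Delta>1 (twist H F) * \<tau>2 (\<tau>1 (\<Delta>1 ?F'))) * ?R13 *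
      X13 H ?F' * \<tau>2 G * ?R23 * inv_of G"
    by (simp only: R13_\<tau>2_\<Delta>1 mult.assoc)
  also have "\<Delta>1 (twist H F) * \<tau>2 (\<tau>1 (\<Delta>1 ?F')) = \<tau>2 (\<tau>1 (\<Delta>2 F * \<Delta>1 ?F'))"
    by (simp add: cycle_comult_right hom_mult)
  also have "\<Delta>2 F * \<Delta>1 ?F' = inv_of G * X12 H F"
    by (simp add: \<Delta>1_inv mult.assoc mult_prefix[OF unital_hom_inverse[OF comult_right_hom]] inv_of
        F_invertible)
  also have "\<tau>2 (\<tau>1 (inv_of G * X12 H F)) = \<tau>2 (\<tau>1 (inv_of G)) * X13 H (twist H F)"
    by (simp add: hom_mult leg_simps)
  finally show ?thesis
    by (simp add: inv_cyc_coassociator shifted_R23_eq twisted_R_def hom_mult mult.assoc)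
qed

text \<open>The mirror image of the previous argument, with the exchange of the first two legs in place of the
  last two.  Now $(1\otimes\Delta)F^{-1}$ is rewritten first, since $\mathcal R_{12}$ is passed by
  $(\Delta\otimes1)F^{-1}$.\<close>

lemma right_coproduct_twisted_R:
  "map_right H (twisted_comult H F) R\<^sub>F =
     shifted_R13 H G * X12 H R\<^sub>F * twisted_coassociator H F"
proof -
  let ?F' = "inv_of F" and ?R12 = "X12 H (Rmat H)" and ?R13 = "X13 H (Rmat H)"
  have "map_right H (twisted_comult H F) R\<^sub>F =
      X23 H F * \<Delta>2 (twist H F) * ?R13 * ?R12 * \<Delta>2 ?F' * X23 H ?F'"
    by (simp add: map_right_twisted_comult twisted_R_def hom_mult R_right mult.assoc)
  also have "\<dots> = X23 H F * \<Delta>2 (twist H F) * ?R13 * (?R12 * \<Delta>1 ?F') * X12 H ?F' * G * X23 H ?F'"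
    by (simp only: \<Delta>2_inv mult.assoc)
  also have "?R12 * \<Delta>1 ?F' = \<tau>1 (\<Delta>2 ?F') * \<tau>1 (inv_of G) * X12 H (twist H F) * ?R12"
    by (simp add: R12_intertwines) (simp add: \<Delta>1_inv hom_mult leg_simps)
  also have "X23 H F * \<Delta>2 (twist H F) * ?R13 *
        (\<tau>1 (\<Delta>2 ?F') * \<tau>1 (inv_of G) * X12 H (twist H F) * ?R12) * X12 H ?F' * G * X23 H ?F' =
      X23 H F * \<Delta>2 (twist H F) * (?R13 * \<tau>1 (\<Delta>2 ?F')) * \<tau>1 (inv_of G) * X12 H R\<^sub>F * G * X23 H ?F'"
    by (simp add: twisted_R_def hom_mult mult.assoc)
  also have "\<dots> = X23 H F * (\<Delta>2 (twist H F) * \<tau>1 (\<tau>2 (\<Delta>2 ?F'))) * ?R13 * \<tau>1 (inv_of G) *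
      X12 H R\<^sub>F * G * X23 H ?F'"
    by (simp only: R13_\<tau>1_\<Delta>2 mult.assoc)
  also have "\<Delta>2 (twist H F) * \<tau>1 (\<tau>2 (\<Delta>2 ?F')) = \<tau>1 (\<tau>2 (\<Delta>1 F * \<Delta>2 ?F'))"
    by (simp add: cycle_comult_left hom_mult)
  also have "\<Delta>1 F * \<Delta>2 ?F' = X12 H ?F' * G"
    by (simp add: \<Delta>2_inv mult.assoc mult_prefix[OF unital_hom_inverse[OF comult_left_hom]] inv_of
        F_invertible)
  also have "\<tau>1 (\<tau>2 (X12 H ?F' * G)) = X23 H ?F' * \<tau>1 (\<tau>2 G)"
    by (simp add: hom_mult leg_simps)
  also have "X23 H F * (X23 H ?F' * \<tau>1 (\<tau>2 G)) = \<tau>1 (\<tau>2 G)"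
    by (simp add: mult_prefix[OF unital_hom_inverse[OF X23_hom]] inv_of F_invertible)
  finally show ?thesis
    by (simp add: coassociator_eq shifted_R13_eq hom_inv_of F_invertible mult.assoc)
qed

text \<open>$(\Delta\otimes1)\mathcal R=\mathcal R_{13}\mathcal R_{23}$ commuted with $\mathcal R_{12}$.\<close>

lemma yang_baxter:
  "X12 H (Rmat H) * X13 H (Rmat H) * X23 H (Rmat H) =
   X23 H (Rmat H) * X13 H (Rmat H) * X12 H (Rmat H)"
  using R12_intertwines[of "Rmat H"] by (simp add: R_left hom_mult leg_simps mult.assoc)

text \<open>The cocycle identity under the permutation that reverses the legs.  The braid relation identifies
  the image of $(1\otimes\Delta)F$ with that of $(\Delta\otimes1)F^T$ under the first transposition.\<close>

lemma reversed_cocycle: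
  "\<tau>2 (\<tau>1 (\<tau>2 G)) * \<tau>1 (\<Delta>1 (twist H F)) = X23 H (twist H F) * \<tau>2 (\<Delta>2 (twist H F))"
proof -
  have "\<tau>2 (\<tau>1 (\<tau>2 G)) * \<tau>1 (\<Delta>1 (twist H F)) = \<tau>2 (\<tau>1 (\<tau>2 (G * \<Delta>2 F)))"
    by (simp add: cycle_comult_right[symmetric] twist_braid hom_mult)
  also have "\<dots> = \<tau>2 (\<tau>1 (\<tau>2 (X12 H F * \<Delta>1 F)))"
    by (simp only: cocycle)
  also have "\<dots> = X23 H (twist H F) * \<tau>2 (\<Delta>2 (twist H F))"
    by (simp add: hom_mult leg_simps cycle_comult_left)
  finally show ?thesis .
qed

text \<open>By the two coproduct formulas each side reduces to a product of the same shape.  In both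
  the factor $\Delta(F^T)$ is commuted with the outer $\mathcal R$; the ordinary Yang--Baxter equation
  then equates the products of $\mathcal R$'s, and \<open>reversed_cocycle\<close> equates what stands to the
  left of them.\<close>

lemma dynamical_yang_baxter:
  "shifted_R12 H G * X13 H R\<^sub>F * shifted_R23 H G = X23 H R\<^sub>F * shifted_R13 H G * X12 H R\<^sub>F"
proof -
  let ?F' = "inv_of F" and ?R12 = "X12 H (Rmat H)" and ?R13 = "X13 H (Rmat H)"
    and ?R23 = "X23 H (Rmat H)"
  have cancel: "X12 H ?F' * (X12 H F * x) = x" "X23 H ?F' * (X23 H F * x) = x" for x
    by (simp_all add: hom_inverse[THEN mult_prefix] inv_of F_invertible)
  have "shifted_R12 H G * X13 H R\<^sub>F * shifted_R23 H G =
      \<tau>2 (\<tau>1 (\<tau>2 G)) * ?R12 * X12 H ?F' *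
        (X12 H F * \<tau>2 (\<tau>1 (inv_of G)) * X13 H R\<^sub>F * shifted_R23 H G)"
    by (simp add: shifted_R12_eq mult.assoc cancel)
  also have "X12 H F * \<tau>2 (\<tau>1 (inv_of G)) * X13 H R\<^sub>F * shifted_R23 H G =
      X12 H F * \<Delta>1 R\<^sub>F * X12 H ?F'"
    by (simp only: left_coproduct_twisted_R[symmetric] inv_cyc_coassociator[symmetric]
        map_left_twisted_comult)
  also have "\<tau>2 (\<tau>1 (\<tau>2 G)) * ?R12 * X12 H ?F' * (X12 H F * \<Delta>1 R\<^sub>F * X12 H ?F') =
      \<tau>2 (\<tau>1 (\<tau>2 G)) * (?R12 * \<Delta>1 (twist H F)) * ?R13 * ?R23 * (\<Delta>1 ?F' * X12 H ?F')"
    by (simp add: twisted_R_def hom_mult R_left mult.assoc cancel)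
  also have "\<dots> = (\<tau>2 (\<tau>1 (\<tau>2 G)) * \<tau>1 (\<Delta>1 (twist H F))) * (?R12 * ?R13 * ?R23) *
      \<Delta>2 ?F' * inv_of G"
    by (simp only: R12_intertwines inverse_cocycle mult.assoc)
  also have "\<dots> = X23 H (twist H F) * (\<tau>2 (\<Delta>2 (twist H F)) * ?R23) * ?R13 * ?R12 *
      \<Delta>2 ?F' * inv_of G"
    by (simp only: reversed_cocycle yang_baxter) (simp only: mult.assoc)
  also have "\<dots> = X23 H (twist H F) * ?R23 * \<Delta>2 R\<^sub>F * inv_of G"
    by (simp only: R23_intertwines[symmetric]) (simp add: twisted_R_def hom_mult R_right mult.assoc)
  also have "\<dots> = X23 H R\<^sub>F * map_right H (twisted_comult H F) R\<^sub>F * X23 H F * inv_of G"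
    by (simp add: twisted_R_def[of H F] map_right_twisted_comult hom_mult mult.assoc cancel)
  also have "\<dots> = X23 H R\<^sub>F * shifted_R13 H G * X12 H R\<^sub>F *
      (G * (inv_of (X23 H F) * X23 H F) * inv_of G)"
    by (simp only: right_coproduct_twisted_R coassociator_eq mult.assoc)
  also have "G * (inv_of (X23 H F) * X23 H F) * inv_of G = 1"
    by (simp add: inv_of F_images_invertible G_invertible)
  finally show ?thesis by simp
qed

end

theorem proposition1:
  fixes H :: "('k::field, 'a::ring_1, 'b::ring_1, 'c::ring_1) hopf_data"
    and D :: "('l::finite \<Rightarrow> 'k) set"
    and h :: "'l \<Rightarrow> 'a"
    and \<F> :: "(('l \<Rightarrow> 'k) \<Rightarrow> 'b) set"
    and \<sigma> :: "('l \<Rightarrow> 'k) \<Rightarrow> (('l \<Rightarrow> 'k) \<Rightarrow> 'b) \<Rightarrow> 'c"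
    and F :: "('l \<Rightarrow> 'k) \<Rightarrow> 'b"
    and lam :: "'l \<Rightarrow> 'k"
  assumes "qt_hopf_superalgebra H"
    and "parameter_shift H D h \<F> \<sigma>"
    and "F \<in> \<F>"
    and "\<forall>\<mu>\<in>D. twistor H (F \<mu>)"
    and "shifted_cocycle H D \<sigma> F"
    and "lam \<in> D"
  shows "(twisted_coassociator H (F lam) = \<sigma> lam F * inv_of (X23 H (F lam))) \<and>
    (\<forall>a. twist H (twisted_comult H (F lam) a) * twisted_R H (F lam)
           = twisted_R H (F lam) * twisted_comult H (F lam) a) \<and>
    (map_left H (twisted_comult H (F lam)) (twisted_R H (F lam))
           = inv_of (cyc231 H (twisted_coassociator H (F lam))) * X13 H (twisted_R H (F lam))
             * shifted_R23 H (\<sigma> lam F)) \<and>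
    (map_right H (twisted_comult H (F lam)) (twisted_R H (F lam))
           = shifted_R13 H (\<sigma> lam F) * X12 H (twisted_R H (F lam))
             * twisted_coassociator H (F lam)) \<and>
    (shifted_R12 H (\<sigma> lam F) * X13 H (twisted_R H (F lam)) * shifted_R23 H (\<sigma> lam F)
           = X23 H (twisted_R H (F lam)) * shifted_R13 H (\<sigma> lam F) * X12 H (twisted_R H (F lam)))"
proof -
  interpret qt_hopf_superalgebra H by fact
  interpret shifted_twist H "F lam" "\<sigma> lam F"
    using assms by unfold_locales (auto simp: shifted_cocycle_def)
  show ?thesis
    using coassociator_eq twisted_R_intertwines left_coproduct_twisted_R right_coproduct_twisted_R
      dynamical_yang_baxter by blast
qed

end
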